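(* Let $\beta>0$ be a fixed constant and let $\gamma\in(0,1]$. For each $n\ge2$ let $a_1=a_1(n)$ and $a_2=a_2(n)$ satisfy $a_1,a_2>\frac\beta2(n-1)$, let $\mu=(\mu_1,\dots,\mu_n)$ be a random vector with the $\beta$-Laguerre density $f_{\beta,a_1}(\mu)$ on $[0,\infty)^n$, and let $\lambda=(\lambda_1,\dots,\lambda_n)$ be a random vector with the $\beta$-Jacobi density $f_{\beta,a_1,a_2}(\lambda)$ on $[0,1]^n$. Assume that $n\to\infty$, $a_1\to\infty$ and $a_2\to\infty$ in such a way that $a_1=o(\sqrt{a_2})$, $n=o(\sqrt{a_2})$ and $\frac{n\beta}{2a_1}\to\gamma$. Then $$\|\mathcal{L}(2a_2\lambda)-\mathcal{L}(\mu)\|\to0,$$ where $\mathcal{L}(Z)$ denotes the probability distribution of $Z$ and $\|\cdot\|$ is the variation distance.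
   Context: Put $p=1+\frac\beta2(n-1)$. The $\beta$-Jacobi ensemble with parameters $a_1,a_2>\frac{\beta}{2}(n-1)$ has density on $[0,1]^n$ $$f_{\beta,a_1,a_2}(\lambda)=c_J^{\beta,a_1,a_2}\prod_{1\le i<j\le n}|\lambda_i-\lambda_j|^\beta\prod_{i=1}^n\lambda_i^{a_1-p}(1-\lambda_i)^{a_2-p},$$ $$c_J^{\beta,a_1,a_2}=\prod_{j=1}^n\frac{\Gamma(1+\frac\beta2)\Gamma(a_1+a_2-\frac\beta2(n-j))}{\Gamma(1+\frac\beta2 j)\Gamma(a_1-\frac\beta2(n-j))\Gamma(a_2-\frac\beta2(n-j))}.$$ The $\beta$-Laguerre ensemble with parameter $a>\frac\beta2(n-1)$ has density on $[0,\infty)^n$ $$f_{\beta,a}(\mu)=c_L^{\beta,a}\prod_{1\le i<j\le n}|\mu_i-\mu_j|^\beta\prod_{i=1}^n\mu_i^{a-p}\,e^{-\frac12\sum_{i=1}^n\mu_i},\qquad c_L^{\beta,a}=2^{-na}\prod_{j=1}^n\frac{\Gamma(1+\frac\beta2)}{\Gamma(1+\frac\beta2j)\Gamma(a-\frac\beta2(n-j))}.$$ For probability measures $P,Q$ on $\mathbb{R}^m$ with Lebesgue densities $f,g$, the variation distance is $\|P-Q\|=2\sup_{A}|P(A)-Q(A)|=\int_{\mathbb{R}^m}|f-g|\,dx$, with supremum over Borel sets $A$. *)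

theory Defs
  imports "HOL-Probability.Probability" "HOL-Library.Landau_Symbols"
begin

text \<open>\<open>\<real>\<^sup>n\<close> with Lebesgue measure, for a dimension \<open>n\<close> that varies inside the statement: vectors are
  functions on \<open>{1..n}\<close>, extended by \<open>undefined\<close> outside. Since \<open>sets lborel = sets borel\<close>, the
  measurable sets are the Borel sets of \<open>\<real>\<^sup>n\<close>.\<close>

definition lebesgue_Rn :: "nat \<Rightarrow> (nat \<Rightarrow> real) measure" where
  "lebesgue_Rn n = (\<Pi>\<^sub>M i\<in>{1..n}. lborel)"

definition scale_Rn :: "nat \<Rightarrow> real \<Rightarrow> (nat \<Rightarrow> real) \<Rightarrow> (nat \<Rightarrow> real)" where
  "scale_Rn n c x = (\<lambda>i\<in>{1..n}. c * x i)"

definition p_exponent :: "real \<Rightarrow> nat \<Rightarrow> real" where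
  "p_exponent \<beta> n = 1 + \<beta> / 2 * (real n - 1)"

definition jacobi_const :: "real \<Rightarrow> nat \<Rightarrow> real \<Rightarrow> real \<Rightarrow> real" where
  "jacobi_const \<beta> n a1 a2 =
     (\<Prod>j=1..n. (Gamma (1 + \<beta> / 2) * Gamma (a1 + a2 - \<beta> / 2 * (real n - real j))) /
        (Gamma (1 + \<beta> / 2 * real j) * Gamma (a1 - \<beta> / 2 * (real n - real j)) *
         Gamma (a2 - \<beta> / 2 * (real n - real j))))"

text \<open>Isabelle has \<open>0 powr x = 0\<close> for every \<open>x\<close>, so the two densities below deviate from the usual
  formulas only on a Lebesgue null set (some coordinate equal to \<open>0\<close> or \<open>1\<close>).\<close>

definition jacobi_density :: "real \<Rightarrow> nat \<Rightarrow> real \<Rightarrow> real \<Rightarrow> (nat \<Rightarrow> real) \<Rightarrow> real" where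
  "jacobi_density \<beta> n a1 a2 x =
     (if \<forall>i\<in>{1..n}. 0 \<le> x i \<and> x i \<le> 1
      then jacobi_const \<beta> n a1 a2 *
           (\<Prod>i=1..n. \<Prod>j\<in>{i<..n}. \<bar>x i - x j\<bar> powr \<beta>) *
           (\<Prod>i=1..n. x i powr (a1 - p_exponent \<beta> n) * (1 - x i) powr (a2 - p_exponent \<beta> n))
      else 0)"

definition laguerre_const :: "real \<Rightarrow> nat \<Rightarrow> real \<Rightarrow> real" where
  "laguerre_const \<beta> n a =
     2 powr (- (real n * a)) *
     (\<Prod>j=1..n. Gamma (1 + \<beta> / 2) /
        (Gamma (1 + \<beta> / 2 * real j) * Gamma (a - \<beta> / 2 * (real n - real j))))"

definition laguerre_density :: "real \<Rightarrow> nat \<Rightarrow> real \<Rightarrow> (nat \<Rightarrow> real) \<Rightarrow> real" where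
  "laguerre_density \<beta> n a x =
     (if \<forall>i\<in>{1..n}. 0 \<le> x i
      then laguerre_const \<beta> n a *
           (\<Prod>i=1..n. \<Prod>j\<in>{i<..n}. \<bar>x i - x j\<bar> powr \<beta>) *
           (\<Prod>i=1..n. x i powr (a - p_exponent \<beta> n)) *
           exp (- (1 / 2) * (\<Sum>i=1..n. x i))
      else 0)"

text \<open>Intended for probability measures with \<open>sets P = sets Q\<close>; the normalisation includes the
  factor 2, so the maximal value is 2.\<close>

definition variation_distance :: "'a measure \<Rightarrow> 'a measure \<Rightarrow> real" where
  "variation_distance P Q = 2 * (SUP A\<in>sets P. \<bar>measure P A - measure Q A\<bar>)"

end

theory Submission imports Defs
begin

text \<open>
  The variation distance is controlled by the entropy of the rescaled Jacobi ensemble relative to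
  the Laguerre ensemble, in this direction because the Jacobi ensemble lives on a cube and all its moments
  exist trivially. After rescaling, the Vandermonde factors and the powers of the coordinates of the
  two densities coincide, and the logarithm of the ratio of the Jacobi to the Laguerre density is
  \<open>ln K + (\<Sum>i. (a2 - p) * ln (1 - x i) + a2 * x i)\<close>, where \<open>K\<close> is a product of quotients
  \<open>Gamma (a1 + a2 - b) / (Gamma (a2 - b) * a2 powr a1)\<close> (\<open>laguerre_scaled_eq_jacobi\<close>). By
  \<open>ln (1 - x) \<le> - x - x\<^sup>2 / 2\<close> this is at most \<open>ln K + p * s1 - (a2 - p) / 2 * s2\<close> with the power
  sums \<open>s1\<close> and \<open>s2\<close>. Hence an upper bound for the entropy requires only the expectation of \<open>s1\<close>, a lower
  bound for the expectation of \<open>s2\<close>, and an upper bound for \<open>ln K\<close>.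

  The moments come from the first two loop equations of the Jacobi ensemble (\<open>loop_equation\<close>). They are
  obtained without differentiating the density: a substitution \<open>\<phi> s = s + c s (1 - s) q s\<close> in every
  coordinate preserves the total mass, and the first-order term in \<open>c\<close> of this invariance is the
  loop equation for the vector field \<open>s (1 - s) q s\<close>. Taking \<open>q = 1\<close> gives the expectation of \<open>s1\<close>
  exactly; taking \<open>q s = s\<close>, together with \<open>s1\<^sup>2 \<le> n * s2\<close>, gives the lower bound for \<open>s2\<close>. The constant
  is estimated with \<open>Digamma x \<le> ln x\<close> (\<open>ln_const_ratio_le\<close>).

  If \<open>m\<close> bounds \<open>n\<close>, \<open>a1\<close> and \<open>p\<close>, each of the contributions is of order \<open>m\<^sup>3 / a2\<close>, which need not tend to \<open>0\<close>. These
  leading terms cancel, and the entropy is \<open>O(m\<^sup>2 / a2)\<close> (\<open>entropy_bound_le\<close>), which tends to \<open>0\<close> when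
  \<open>n\<close> and \<open>a1\<close> are \<open>o(sqrt a2)\<close>. The passage from entropy to variation distance is a pointwise form of
  Pinsker's inequality (\<open>one_minus_le_entropy\<close>, \<open>measure_diff_le\<close>).\<close>

section \<open>Coordinatewise substitutions in product measures\<close>

text \<open>A weight that is a product over the coordinates and a map that acts coordinatewise both preserve
  boxes, so the image measure is determined by the one-dimensional integrals.\<close>

lemma distr_density_PiM:
  fixes \<phi> :: "real \<Rightarrow> real" and w w' :: "real \<Rightarrow> ennreal"
  assumes I: "finite I"
    and [measurable]: "\<phi> \<in> borel_measurable borel" "w \<in> borel_measurable borel"
      "w' \<in> borel_measurable borel"
    and sf: "sigma_finite_measure (density lborel w')"
    and subst: "\<And>A. A \<in> sets borel \<Longrightarrow>
      (\<integral>\<^sup>+x. w x * indicator A (\<phi> x) \<partial>lborel) = (\<integral>\<^sup>+x. w' x * indicator A x \<partial>lborel)"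
  shows "distr (density (PiM I (\<lambda>_. lborel)) (\<lambda>x. \<Prod>i\<in>I. w (x i))) (PiM I (\<lambda>_. lborel))
           (\<lambda>x. \<lambda>i\<in>I. \<phi> (x i)) = PiM I (\<lambda>_. density lborel w')" (is "distr ?D ?P ?T = ?R")
proof (rule product_sigma_finite.PiM_eqI)
  show "product_sigma_finite (\<lambda>_. density lborel w')"
    using sf by (simp add: product_sigma_finite_def)
  show "finite I" by fact
  show "sets (distr ?D ?P ?T) = sets ?R"
    by (simp, intro sets_PiM_cong) auto
  fix A :: "'a \<Rightarrow> real set" assume "\<And>i. i \<in> I \<Longrightarrow> A i \<in> sets (density lborel w')"
  then have A[measurable]: "\<And>i. i \<in> I \<Longrightarrow> A i \<in> sets borel" by simp
  interpret product_sigma_finite "\<lambda>_::'a. lborel :: real measure"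
    by (simp add: product_sigma_finite_def lborel.sigma_finite_measure_axioms)
  have box: "Pi\<^sub>E I A \<in> sets ?P" using I A by (intro sets_PiM_I_finite) auto
  have T: "?T \<in> measurable ?P ?P" by measurable
  have "emeasure (distr ?D ?P ?T) (Pi\<^sub>E I A) = emeasure ?D (?T -` Pi\<^sub>E I A \<inter> space ?P)"
    using box T by (subst emeasure_distr) auto
  also have "\<dots> = (\<integral>\<^sup>+x. (\<Prod>i\<in>I. w (x i)) * indicator (?T -` Pi\<^sub>E I A \<inter> space ?P) x \<partial>?P)"
    using box T I by (intro emeasure_density measurable_sets) measurable
  also have "\<dots> = (\<integral>\<^sup>+x. (\<Prod>i\<in>I. w (x i) * indicator (A i) (\<phi> (x i))) \<partial>?P)"
  proof (rule nn_integral_cong)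
    fix x :: "'a \<Rightarrow> real" assume x: "x \<in> space ?P"
    have "indicator (?T -` Pi\<^sub>E I A \<inter> space ?P) x = (\<Prod>i\<in>I. indicator (A i) (\<phi> (x i)) :: ennreal)"
    proof (cases "\<forall>i\<in>I. \<phi> (x i) \<in> A i")
      case True then show ?thesis using x by (auto simp: indicator_def PiE_iff)
    next
      case False
      then obtain i where i: "i \<in> I" "\<phi> (x i) \<notin> A i" by auto
      then have "(\<Prod>i\<in>I. indicator (A i) (\<phi> (x i)) :: ennreal) = 0"
        using I by (intro prod_zero) (auto intro!: bexI[of _ i])
      moreover have "?T x \<notin> Pi\<^sub>E I A" using i by auto
      ultimately show ?thesis by (simp add: indicator_def)
    qed
    then show "(\<Prod>i\<in>I. w (x i)) * indicator (?T -` Pi\<^sub>E I A \<inter> space ?P) x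
       = (\<Prod>i\<in>I. w (x i) * indicator (A i) (\<phi> (x i)))"
      by (simp add: prod.distrib)
  qed
  also have "\<dots> = (\<Prod>i\<in>I. \<integral>\<^sup>+x. w x * indicator (A i) (\<phi> x) \<partial>lborel)"
    by (rule product_nn_integral_prod[OF I]) measurable
  also have "\<dots> = (\<Prod>i\<in>I. emeasure (density lborel w') (A i))"
    by (intro prod.cong refl) (simp add: subst emeasure_density)
  finally show "emeasure (distr ?D ?P ?T) (Pi\<^sub>E I A) = (\<Prod>i\<in>I. emeasure (density lborel w') (A i))" .
qed

text \<open>The determinant of a coordinatewise map is the product of the one-dimensional derivatives. The
  one-dimensional change of variables is a hypothesis, so that the same lemma serves for scalings of
  the whole line (\<open>w' = 1\<close>) and for maps of the unit interval onto itself
  (\<open>w'\<close> the indicator of \<open>{0..1}\<close>).\<close>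

lemma nn_integral_PiM_substitution:
  fixes \<phi> :: "real \<Rightarrow> real" and w w' :: "real \<Rightarrow> ennreal"
  assumes I: "finite I"
    and [measurable]: "\<phi> \<in> borel_measurable borel" "w \<in> borel_measurable borel"
      "w' \<in> borel_measurable borel" "F \<in> borel_measurable (PiM I (\<lambda>_. lborel))"
    and sf: "sigma_finite_measure (density lborel w')"
    and subst: "\<And>A. A \<in> sets borel \<Longrightarrow>
      (\<integral>\<^sup>+x. w x * indicator A (\<phi> x) \<partial>lborel) = (\<integral>\<^sup>+x. w' x * indicator A x \<partial>lborel)"
  shows "(\<integral>\<^sup>+x. (\<Prod>i\<in>I. w (x i)) * F (\<lambda>i\<in>I. \<phi> (x i)) \<partial>PiM I (\<lambda>_. lborel)) =
         (\<integral>\<^sup>+x. (\<Prod>i\<in>I. w' (x i)) * F x \<partial>PiM I (\<lambda>_. lborel))"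
proof -
  let ?P = "PiM I (\<lambda>_. lborel :: real measure)"
  have wm[measurable]: "(\<lambda>x. \<Prod>i\<in>I. w (x i)) \<in> borel_measurable ?P"
      "(\<lambda>x. \<Prod>i\<in>I. w' (x i)) \<in> borel_measurable ?P"
    by measurable
  have T[measurable]: "(\<lambda>x. \<lambda>i\<in>I. \<phi> (x i)) \<in> measurable ?P ?P" by measurable
  have R: "(\<lambda>x. \<lambda>i\<in>I. x i) \<in> measurable ?P ?P" by measurable
  have "(\<integral>\<^sup>+x. (\<Prod>i\<in>I. w (x i)) * F (\<lambda>i\<in>I. \<phi> (x i)) \<partial>?P)
    = (\<integral>\<^sup>+x. F x \<partial>distr (density ?P (\<lambda>x. \<Prod>i\<in>I. w (x i))) ?P (\<lambda>x. \<lambda>i\<in>I. \<phi> (x i)))"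
    by (subst nn_integral_distr) (simp_all add: nn_integral_density)
  also have "\<dots> = (\<integral>\<^sup>+x. F x \<partial>PiM I (\<lambda>_. density lborel w'))"
    by (subst distr_density_PiM[OF I _ _ _ sf subst]) auto
  \<comment> \<open>The same identity for the identity map turns the product of the weighted lines back into a density.\<close>
  also have "\<dots> = (\<integral>\<^sup>+x. F x \<partial>distr (density ?P (\<lambda>x. \<Prod>i\<in>I. w' (x i))) ?P (\<lambda>x. \<lambda>i\<in>I. x i))"
    by (subst distr_density_PiM[OF I _ _ _ sf]) auto
  also have "\<dots> = (\<integral>\<^sup>+x. (\<Prod>i\<in>I. w' (x i)) * F (\<lambda>i\<in>I. x i) \<partial>?P)"
    using R by (subst nn_integral_distr) (simp_all add: nn_integral_density)
  also have "\<dots> = (\<integral>\<^sup>+x. (\<Prod>i\<in>I. w' (x i)) * F x \<partial>?P)"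
    by (intro nn_integral_cong) (auto simp: space_PiM PiE_def extensional_restrict)
  finally show ?thesis .
qed

section \<open>Elementary inequalities\<close>

text \<open>Two-body terms become polynomials in power sums once the sum over pairs is replaced by a full
  double sum minus its diagonal.\<close>

lemma sum_pairs_symmetric:
  fixes F :: "nat \<Rightarrow> nat \<Rightarrow> real"
  assumes sym: "\<And>i j. F i j = F j i"
  shows "2 * (\<Sum>i=1..n. \<Sum>j\<in>{i<..n}. F i j) = (\<Sum>i=1..n. \<Sum>j=1..n. F i j) - (\<Sum>i=1..n. F i i)"
proof (induction n)
  case (Suc n)
  have *: "{i<..Suc n} = insert (Suc n) {i<..n}" if "i \<in> {1..n}" for i using that by auto
  have "(\<Sum>i=1..Suc n. \<Sum>j\<in>{i<..Suc n}. F i j)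
      = (\<Sum>i=1..n. \<Sum>j\<in>{i<..n}. F i j) + (\<Sum>i=1..n. F i (Suc n))"
    by (simp add: * sum.distrib)
  moreover have "(\<Sum>i=1..n. F (Suc n) i) = (\<Sum>i=1..n. F i (Suc n))"
    by (intro sum.cong refl sym)
  ultimately show ?case using Suc by (simp add: sum.distrib)
qed simp

text \<open>A number that plays the role of a derivative at \<open>c = 0\<close>: one-sided second-order bounds
  for both signs of \<open>c\<close> force it to vanish. This replaces differentiation under the integral sign.\<close>

lemma eq_zero_of_quadratic_bound:
  fixes X C c0 :: real
  assumes c0: "0 < c0" and C: "0 \<le> C" and bd: "\<And>c. \<bar>c\<bar> \<le> c0 \<Longrightarrow> c * X \<le> C * c\<^sup>2"
  shows "X = 0"
proof (rule ccontr)
  assume X: "X \<noteq> 0"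
  define t where "t = min c0 (\<bar>X\<bar> / (2 * (C + 1)))"
  have t: "0 < t" "t \<le> c0" "t \<le> \<bar>X\<bar> / (2 * (C + 1))" using c0 C X by (auto simp: t_def)
  have "(sgn X * t) * X \<le> C * (sgn X * t)\<^sup>2" using t by (intro bd) (auto simp: abs_mult sgn_if)
  also have "(sgn X * t) * X = t * \<bar>X\<bar>" by (auto simp: sgn_if)
  also have "C * (sgn X * t)\<^sup>2 = t * (C * t)" using X by (auto simp: sgn_if power2_eq_square)
  finally have "\<bar>X\<bar> \<le> C * t" using t by simp
  also have "\<dots> \<le> (C + 1) * t" using t by simp
  also have "\<dots> \<le> (C + 1) * (\<bar>X\<bar> / (2 * (C + 1)))" using t C by (intro mult_left_mono) auto
  also have "\<dots> = \<bar>X\<bar> / 2" using C by (simp add: field_simps)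
  finally show False using X by simp
qed

text \<open>The exponent has error quadratic in \<open>c\<close>, uniformly in \<open>t\<close>. The exponential form is chosen because a
  product of such bounds is again of this form.\<close>

lemma one_plus_powr_ge:
  fixes t B c \<alpha> :: real
  assumes "\<bar>t\<bar> \<le> B" "\<bar>c\<bar> * B \<le> 1 / 2"
  shows "exp (c * (\<alpha> * t) - c\<^sup>2 * (2 * B\<^sup>2 * \<bar>\<alpha>\<bar>)) \<le> (1 + c * t) powr \<alpha>"
proof -
  have ct: "\<bar>c * t\<bar> \<le> 1 / 2"
    using assms mult_left_mono[of "\<bar>t\<bar>" B "\<bar>c\<bar>"] by (simp add: abs_mult)
  have "\<bar>ln (1 + c * t) - c * t\<bar> \<le> 2 * (c * t)\<^sup>2"
    using ct by (intro abs_ln_one_plus_x_minus_x_bound) auto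
  also have "\<dots> \<le> 2 * (c\<^sup>2 * B\<^sup>2)"
    using assms by (simp add: power_mult_distrib) (intro mult_left_mono, auto simp: abs_le_square_iff[symmetric])
  finally have "\<bar>\<alpha>\<bar> * \<bar>ln (1 + c * t) - c * t\<bar> \<le> \<bar>\<alpha>\<bar> * (2 * (c\<^sup>2 * B\<^sup>2))"
    by (intro mult_left_mono) auto
  then have "\<bar>\<alpha> * ln (1 + c * t) - c * (\<alpha> * t)\<bar> \<le> c\<^sup>2 * (2 * B\<^sup>2 * \<bar>\<alpha>\<bar>)"
    unfolding abs_mult[symmetric] by (simp add: algebra_simps)
  then have "c * (\<alpha> * t) - c\<^sup>2 * (2 * B\<^sup>2 * \<bar>\<alpha>\<bar>) \<le> \<alpha> * ln (1 + c * t)" by linarith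
  moreover have "0 < 1 + c * t" using ct by (auto simp: abs_le_iff)
  ultimately show ?thesis by (simp add: powr_def)
qed

text \<open>The pointwise form of Pinsker's inequality: \<open>r - 1 - ln r\<close> dominates \<open>(1 - r)\<^sup>2 / 2\<close> for
  \<open>r \<le> 1\<close>, and the square root is linearised with the parameter \<open>\<epsilon>\<close>. With \<open>r\<close> a likelihood ratio, the
  expectation of \<open>r - 1 - ln r\<close> is at most the relative entropy.\<close>

lemma one_minus_le_entropy:
  fixes r \<epsilon> :: real
  assumes r: "0 < r" and \<epsilon>: "0 < \<epsilon>"
  shows "1 - r \<le> \<epsilon> / 2 + (r - 1 - ln r) / \<epsilon>" "0 \<le> \<epsilon> / 2 + (r - 1 - ln r) / \<epsilon>"
proof -
  have nn: "0 \<le> r - 1 - ln r" using ln_le_minus_one[OF r] by simp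
  then show pos: "0 \<le> \<epsilon> / 2 + (r - 1 - ln r) / \<epsilon>" using \<epsilon> by simp
  show "1 - r \<le> \<epsilon> / 2 + (r - 1 - ln r) / \<epsilon>"
  proof (cases "r \<le> 1")
    case False then show ?thesis using pos by linarith
  next
    case True
    let ?g = "\<lambda>s. s - 1 - ln s - (1 - s)\<^sup>2 / 2"
    have "?g r \<ge> ?g 1"
    proof (rule DERIV_nonpos_imp_nonincreasing[OF True], intro exI conjI)
      fix t assume t: "r \<le> t" "t \<le> 1"
      show "(?g has_real_derivative - ((1 - t)\<^sup>2 / t)) (at t)"
        using r t by (auto intro!: derivative_eq_intros simp: field_simps power2_eq_square)
      show "- ((1 - t)\<^sup>2 / t) \<le> 0" using r t by simp
    qed
    then have "(1 - r)\<^sup>2 / 2 \<le> r - 1 - ln r" by simp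
    then have "(1 - r)\<^sup>2 / 2 / \<epsilon> \<le> (r - 1 - ln r) / \<epsilon>" using \<epsilon> by (intro divide_right_mono) auto
    moreover have "1 - r \<le> \<epsilon> / 2 + (1 - r)\<^sup>2 / 2 / \<epsilon>"
    proof -
      have "0 \<le> (\<epsilon> - (1 - r))\<^sup>2 / (2 * \<epsilon>)" using \<epsilon> by simp
      also have "\<dots> = \<epsilon> / 2 + (1 - r)\<^sup>2 / 2 / \<epsilon> - (1 - r)"
        using \<epsilon> by (simp add: field_simps power2_eq_square)
      finally show ?thesis by simp
    qed
    ultimately show ?thesis by linarith
  qed
qed

lemma ln_one_minus_le_quadratic:
  fixes x :: real
  assumes "0 \<le> x" "x < 1"
  shows "ln (1 - x) \<le> - x - x\<^sup>2 / 2"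
proof -
  let ?g = "\<lambda>t. - t - t\<^sup>2 / 2 - ln (1 - t)"
  have "?g 0 \<le> ?g x"
  proof (rule DERIV_nonneg_imp_nondecreasing[OF assms(1)], intro exI conjI)
    fix t assume t: "0 \<le> t" "t \<le> x"
    show "(?g has_real_derivative t\<^sup>2 / (1 - t)) (at t)"
      using assms t by (auto intro!: derivative_eq_intros simp: field_simps power2_eq_square)
    show "0 \<le> t\<^sup>2 / (1 - t)" using assms t by simp
  qed
  then show ?thesis by simp
qed

section \<open>The densities\<close>

lemma coordinate_measurable: "i \<in> {1..n} \<Longrightarrow> (\<lambda>x. x i) \<in> borel_measurable (lebesgue_Rn n)"
  using measurable_component_singleton[of i "{1..n}" "\<lambda>_. lborel :: real measure"]
  by (simp add: lebesgue_Rn_def)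

lemma jacobi_density_measurable [measurable]:
  "jacobi_density \<beta> n a1 a2 \<in> borel_measurable (lebesgue_Rn n)"
proof -
  note [measurable] = coordinate_measurable
  have "(\<lambda>x. \<Prod>i=1..n. \<Prod>j\<in>{i<..n}. \<bar>x i - x j\<bar> powr \<beta>) \<in> borel_measurable (lebesgue_Rn n)"
    by (intro borel_measurable_prod powr_real_measurable borel_measurable_abs borel_measurable_diff
        coordinate_measurable) auto
  moreover have "(\<lambda>x. \<Prod>i=1..n. x i powr (a1 - p_exponent \<beta> n) * (1 - x i) powr (a2 - p_exponent \<beta> n))
      \<in> borel_measurable (lebesgue_Rn n)"
    by (intro borel_measurable_prod borel_measurable_times powr_real_measurable
        borel_measurable_diff coordinate_measurable) auto
  moreover have "Measurable.pred (lebesgue_Rn n) (\<lambda>x. \<forall>i\<in>{1..n}. 0 \<le> x i \<and> x i \<le> 1)"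
    by measurable
  ultimately show ?thesis unfolding jacobi_density_def by measurable
qed

lemma laguerre_density_measurable [measurable]:
  "laguerre_density \<beta> n a \<in> borel_measurable (lebesgue_Rn n)"
proof -
  note [measurable] = coordinate_measurable
  have "(\<lambda>x. \<Prod>i=1..n. \<Prod>j\<in>{i<..n}. \<bar>x i - x j\<bar> powr \<beta>) \<in> borel_measurable (lebesgue_Rn n)"
    by (intro borel_measurable_prod powr_real_measurable borel_measurable_abs borel_measurable_diff
        coordinate_measurable) auto
  moreover have "(\<lambda>x. \<Prod>i=1..n. x i powr (a - p_exponent \<beta> n)) \<in> borel_measurable (lebesgue_Rn n)"
    by (intro borel_measurable_prod powr_real_measurable coordinate_measurable) auto
  moreover have "(\<lambda>x. \<Sum>i=1..n. x i) \<in> borel_measurable (lebesgue_Rn n)"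
    by (intro borel_measurable_sum coordinate_measurable)
  moreover have "Measurable.pred (lebesgue_Rn n) (\<lambda>x. \<forall>i\<in>{1..n}. 0 \<le> x i)"
    by measurable
  ultimately show ?thesis unfolding laguerre_density_def by measurable
qed

text \<open>The lower bounds on the parameters say exactly that the Gamma factor with the smallest argument,
  the one for \<open>j = 1\<close>, has a positive argument.\<close>

lemma jacobi_const_pos:
  assumes "\<beta> > 0" "a1 > \<beta> / 2 * (real n - 1)" "a2 > \<beta> / 2 * (real n - 1)"
  shows "jacobi_const \<beta> n a1 a2 > 0"
  unfolding jacobi_const_def
proof (intro prod_pos)
  fix j assume j: "j \<in> {1..n}"
  have \<beta>j: "0 \<le> \<beta> / 2 * real j" using assms(1) by simp
  from j have "\<beta> / 2 * (real n - real j) \<le> \<beta> / 2 * (real n - 1)" "0 \<le> \<beta> / 2 * (real n - real j)"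
    using assms(1) by (auto intro!: mult_left_mono)
  then show "0 < Gamma (1 + \<beta> / 2) * Gamma (a1 + a2 - \<beta> / 2 * (real n - real j)) /
        (Gamma (1 + \<beta> / 2 * real j) * Gamma (a1 - \<beta> / 2 * (real n - real j)) *
         Gamma (a2 - \<beta> / 2 * (real n - real j)))"
    using assms \<beta>j by (intro divide_pos_pos mult_pos_pos Gamma_real_pos) linarith+
qed

lemma laguerre_const_pos:
  assumes "\<beta> > 0" "a > \<beta> / 2 * (real n - 1)"
  shows "laguerre_const \<beta> n a > 0"
  unfolding laguerre_const_def
proof (intro mult_pos_pos prod_pos)
  fix j assume j: "j \<in> {1..n}"
  have \<beta>j: "0 \<le> \<beta> / 2 * real j" using assms(1) by simp
  from j have "\<beta> / 2 * (real n - real j) \<le> \<beta> / 2 * (real n - 1)"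
    using assms(1) by (auto intro!: mult_left_mono)
  then show "0 < Gamma (1 + \<beta> / 2) / (Gamma (1 + \<beta> / 2 * real j) * Gamma (a - \<beta> / 2 * (real n - real j)))"
    using assms \<beta>j by (intro divide_pos_pos mult_pos_pos Gamma_real_pos) linarith+
qed auto

section \<open>Loop equations for the Jacobi ensemble\<close>

definition jacobi_measure :: "real \<Rightarrow> nat \<Rightarrow> real \<Rightarrow> real \<Rightarrow> (nat \<Rightarrow> real) measure" where
  "jacobi_measure \<beta> n a1 a2 = density (lebesgue_Rn n) (\<lambda>x. ennreal (jacobi_density \<beta> n a1 a2 x))"

text \<open>Normalisation enters as a hypothesis at a single pair of parameters. All moment information below
  is extracted from it by substitutions.\<close>

locale jacobi_ensemble =
  fixes \<beta> :: real and n :: nat and a1 a2 :: real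
  assumes \<beta>_pos: "\<beta> > 0" and a1: "a1 > \<beta> / 2 * (real n - 1)" and a2: "a2 > \<beta> / 2 * (real n - 1)"
    and prob: "prob_space (jacobi_measure \<beta> n a1 a2)"
begin

abbreviation "p \<equiv> p_exponent \<beta> n"
abbreviation "J \<equiv> jacobi_measure \<beta> n a1 a2"
abbreviation "f \<equiv> jacobi_density \<beta> n a1 a2"

sublocale prob_space J by (rule prob)

lemma f_nonneg: "0 \<le> f x"
  using jacobi_const_pos[OF \<beta>_pos a1 a2]
  by (auto simp: jacobi_density_def intro!: mult_nonneg_nonneg prod_nonneg)

lemma measurable_J: "g \<in> borel_measurable (lebesgue_Rn n) \<Longrightarrow> g \<in> borel_measurable J"
  by (simp add: jacobi_measure_def)

lemma nn_integral_f: "(\<integral>\<^sup>+x. ennreal (f x) \<partial>lebesgue_Rn n) = 1"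
  using emeasure_space_1 by (simp add: jacobi_measure_def emeasure_density cong: nn_integral_cong)

lemma AE_support: "AE x in J. f x > 0"
  unfolding jacobi_measure_def by (subst AE_density) auto

lemma support_cube: "f x > 0 \<Longrightarrow> \<forall>i\<in>{1..n}. 0 \<le> x i \<and> x i \<le> 1"
  by (auto simp: jacobi_density_def split: if_splits)

lemma integrable_bounded_on_cube:
  fixes g :: "_ \<Rightarrow> real"
  assumes "g \<in> borel_measurable (lebesgue_Rn n)"
    and "\<And>x. \<forall>i\<in>{1..n}. 0 \<le> x i \<and> x i \<le> 1 \<Longrightarrow> \<bar>g x\<bar> \<le> B"
  shows "integrable J g"
  by (rule integrable_const_bound[of _ B])
     (use AE_support in eventually_elim, use assms support_cube measurable_J in auto)

text \<open>A substitution fixing \<open>0\<close> and \<open>1\<close> multiplies the factors \<open>x\<close>, \<open>1 - x\<close> and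
  \<open>x - y\<close> of the density by factors \<open>l\<close>, \<open>r\<close> and \<open>D\<close>. Stated multiplicatively, the transformation rule
  also covers the points where the density is zero.\<close>

lemma jacobi_density_substitution:
  fixes h \<phi> :: "real \<Rightarrow> real" and D :: "real \<Rightarrow> real \<Rightarrow> real"
  assumes x: "\<forall>i\<in>{1..n}. 0 \<le> x i \<and> x i \<le> 1"
    and \<phi>: "\<And>s. 0 \<le> s \<Longrightarrow> s \<le> 1 \<Longrightarrow> 0 \<le> \<phi> s \<and> \<phi> s \<le> 1"
    and D: "\<And>s t. 0 \<le> s \<Longrightarrow> s \<le> 1 \<Longrightarrow> 0 \<le> t \<Longrightarrow> t \<le> 1 \<Longrightarrow> \<phi> s - \<phi> t = (s - t) * D s t"
      "\<And>s t. 0 \<le> s \<Longrightarrow> s \<le> 1 \<Longrightarrow> 0 \<le> t \<Longrightarrow> t \<le> 1 \<Longrightarrow> 0 \<le> D s t"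
    and L: "\<And>s. 0 \<le> s \<Longrightarrow> s \<le> 1 \<Longrightarrow> \<phi> s = s * l s" "\<And>s. 0 \<le> s \<Longrightarrow> s \<le> 1 \<Longrightarrow> 0 \<le> l s"
    and R: "\<And>s. 0 \<le> s \<Longrightarrow> s \<le> 1 \<Longrightarrow> 1 - \<phi> s = (1 - s) * r s" "\<And>s. 0 \<le> s \<Longrightarrow> s \<le> 1 \<Longrightarrow> 0 \<le> r s"
  shows "f (\<lambda>i\<in>{1..n}. \<phi> (x i)) = f x * ((\<Prod>i=1..n. \<Prod>j\<in>{i<..n}. D (x i) (x j) powr \<beta>) *
           (\<Prod>i=1..n. l (x i) powr (a1 - p) * r (x i) powr (a2 - p)))"
proof -
  let ?y = "\<lambda>i\<in>{1..n}. \<phi> (x i)"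
  have 1: "(\<Prod>i=1..n. \<Prod>j\<in>{i<..n}. \<bar>?y i - ?y j\<bar> powr \<beta>) =
      (\<Prod>i=1..n. \<Prod>j\<in>{i<..n}. \<bar>x i - x j\<bar> powr \<beta>) * (\<Prod>i=1..n. \<Prod>j\<in>{i<..n}. D (x i) (x j) powr \<beta>)"
    unfolding prod.distrib[symmetric]
    by (intro prod.cong refl) (use x D in \<open>simp add: abs_mult powr_mult\<close>)
  have 2: "(\<Prod>i=1..n. ?y i powr (a1 - p) * (1 - ?y i) powr (a2 - p)) =
      (\<Prod>i=1..n. x i powr (a1 - p) * (1 - x i) powr (a2 - p)) *
      (\<Prod>i=1..n. l (x i) powr (a1 - p) * r (x i) powr (a2 - p))"
    unfolding prod.distrib[symmetric]
  proof (intro prod.cong refl)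
    fix i assume "i \<in> {1..n}"
    with x have xi: "0 \<le> x i" "x i \<le> 1" by auto
    show "?y i powr (a1 - p) * (1 - ?y i) powr (a2 - p) =
      x i powr (a1 - p) * (1 - x i) powr (a2 - p) * (l (x i) powr (a1 - p) * r (x i) powr (a2 - p))"
      using \<open>i \<in> {1..n}\<close> xi R(1)[OF xi] R(2)[OF xi] L(2)[OF xi]
      by (simp add: powr_mult L(1)[OF xi])
  qed
  have 3: "\<forall>i\<in>{1..n}. 0 \<le> ?y i \<and> ?y i \<le> 1" using x \<phi> by auto
  show ?thesis unfolding jacobi_density_def if_P[OF 3] if_P[OF x] 1 2 by simp
qed

text \<open>Integration by parts along the vector field \<open>s (1 - s) (u + v s)\<close> is replaced by the substitution
  \<open>\<phi> s = s + c s (1 - s) (u + v s)\<close>, because the partial derivatives of the density are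
  singular for \<open>\<beta> < 1\<close> and at the faces of the cube. The substitution maps \<open>[0,1]\<close> onto itself, so
  the ratio \<open>G\<close> of the transported to the original density has expectation \<open>1\<close>; since
  \<open>G \<ge> 1 + ln G \<ge> 1 + c L - C c\<^sup>2\<close> with \<open>L\<close> the derivative of \<open>ln G\<close> at \<open>c = 0\<close>, the bound follows.
  Here \<open>D\<close> is the difference quotient of the vector field, and \<open>D s s\<close> its derivative.\<close>

lemma loop_equation_quadratic_error:
  fixes u v c :: real
  defines "B \<equiv> \<bar>u\<bar> + 3 * \<bar>v\<bar> + 1"
  defines "q \<equiv> \<lambda>s. u + v * s"
    and "D \<equiv> \<lambda>s t. u * (1 - s - t) + v * (s + t - s\<^sup>2 - s * t - t\<^sup>2)"
  defines "L \<equiv> \<lambda>x. \<beta> * (\<Sum>i=1..n. \<Sum>j\<in>{i<..n}. D (x i) (x j)) +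
      (\<Sum>i=1..n. (a1 - p) * ((1 - x i) * q (x i)) + (a2 - p) * (- (x i * q (x i))) + D (x i) (x i))"
  defines "C \<equiv> 2 * B\<^sup>2 * (\<beta> * (\<Sum>i=1..n. \<Sum>j\<in>{i<..n}. 1) + real n * (\<bar>a1 - p\<bar> + \<bar>a2 - p\<bar> + 1))"
  assumes c: "\<bar>c\<bar> * B \<le> 1 / 2"
  shows "c * expectation L \<le> C * c\<^sup>2" "0 \<le> C"
proof -
  show "0 \<le> C" unfolding C_def using \<beta>_pos
    by (intro mult_nonneg_nonneg add_nonneg_nonneg sum_nonneg) auto
  define \<phi> where "\<phi> = (\<lambda>s. s + c * (s * (1 - s) * q s))"
  define G where "G = (\<lambda>x. (\<Prod>i=1..n. \<Prod>j\<in>{i<..n}. (1 + c * D (x i) (x j)) powr \<beta>) *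
           (\<Prod>i=1..n. (1 + c * ((1 - x i) * q (x i))) powr (a1 - p) * (1 + c * (- (x i * q (x i)))) powr (a2 - p)
              * (1 + c * D (x i) (x i)) powr 1))"
  have qB: "\<bar>q s\<bar> \<le> B" if "0 \<le> s" "s \<le> 1" for s
  proof -
    have "\<bar>v * s\<bar> \<le> \<bar>v\<bar>" using that by (simp add: abs_mult mult_left_le)
    then show ?thesis unfolding q_def B_def by linarith
  qed
  have tB: "\<bar>t * y\<bar> \<le> B" if "0 \<le> t" "t \<le> 1" "\<bar>y\<bar> \<le> B" for t y
    using that mult_mono[of "\<bar>t\<bar>" 1 "\<bar>y\<bar>" B] by (simp add: abs_mult)
  have DB: "\<bar>D s t\<bar> \<le> B" if "0 \<le> s" "s \<le> 1" "0 \<le> t" "t \<le> 1" for s t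
  proof -
    have "0 \<le> s * t" "s * t \<le> 1" "0 \<le> s\<^sup>2" "s\<^sup>2 \<le> 1" "0 \<le> t\<^sup>2" "t\<^sup>2 \<le> 1"
      using that by (auto simp: mult_le_one power_le_one)
    then have "\<bar>s + t - s\<^sup>2 - s * t - t\<^sup>2\<bar> \<le> 3" "\<bar>1 - s - t\<bar> \<le> 1" using that by linarith+
    then have "\<bar>v * (s + t - s\<^sup>2 - s * t - t\<^sup>2)\<bar> \<le> \<bar>v\<bar> * 3" "\<bar>u * (1 - s - t)\<bar> \<le> \<bar>u\<bar> * 1"
      unfolding abs_mult by (intro mult_left_mono; simp)+
    then show ?thesis unfolding D_def B_def by linarith
  qed
  have pos: "0 \<le> 1 + c * y" if "\<bar>y\<bar> \<le> B" for y
  proof -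
    have "\<bar>c * y\<bar> \<le> \<bar>c\<bar> * B" unfolding abs_mult using that by (intro mult_left_mono) auto
    then show ?thesis using c by linarith
  qed
  have deriv: "(\<phi> has_real_derivative (1 + c * D s s)) (at s)" for s
    unfolding \<phi>_def D_def q_def
    by (auto intro!: derivative_eq_intros simp: algebra_simps power2_eq_square)
  have Dpos: "0 \<le> 1 + c * D s s" if "s \<in> {0..1}" for s using that by (intro pos DB) auto
  have \<phi>D: "\<phi> s - \<phi> t = (s - t) * (1 + c * D s t)" for s t
    unfolding \<phi>_def D_def q_def by (simp add: algebra_simps power2_eq_square)
  have \<phi>l: "\<phi> s = s * (1 + c * ((1 - s) * q s))" and \<phi>r: "1 - \<phi> s = (1 - s) * (1 + c * (- (s * q s)))" for s
    unfolding \<phi>_def by (simp_all add: algebra_simps)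
  have lpos: "0 \<le> 1 + c * ((1 - s) * q s)" and rpos: "0 \<le> 1 + c * (- (s * q s))" if "0 \<le> s" "s \<le> 1" for s
    using that by (intro pos; simp only: abs_minus_cancel; intro tB qB; simp)+
  have \<phi>01: "0 \<le> \<phi> s \<and> \<phi> s \<le> 1" if "0 \<le> s" "s \<le> 1" for s
    using mult_nonneg_nonneg[OF that(1) lpos[OF that]] mult_nonneg_nonneg[OF _ rpos[OF that], of "1 - s"]
      that unfolding \<phi>l[symmetric] \<phi>r[symmetric] by auto
  have fG: "(\<Prod>i=1..n. 1 + c * D (x i) (x i)) * f (\<lambda>i\<in>{1..n}. \<phi> (x i)) = f x * G x"
    if x: "\<forall>i\<in>{1..n}. 0 \<le> x i \<and> x i \<le> 1" for x
  proof -
    have "(\<Prod>i=1..n. 1 + c * D (x i) (x i)) = (\<Prod>i=1..n. (1 + c * D (x i) (x i)) powr 1)"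
      using x by (intro prod.cong refl) (simp add: pos DB)
    moreover have "f (\<lambda>i\<in>{1..n}. \<phi> (x i)) = f x * ((\<Prod>i=1..n. \<Prod>j\<in>{i<..n}. (1 + c * D (x i) (x j)) powr \<beta>) *
           (\<Prod>i=1..n. (1 + c * ((1 - x i) * q (x i))) powr (a1 - p) * (1 + c * (- (x i * q (x i)))) powr (a2 - p)))"
    proof (rule jacobi_density_substitution[OF x])
      show "0 \<le> 1 + c * D s t" if "0 \<le> s" "s \<le> 1" "0 \<le> t" "t \<le> 1" for s t
        using that by (intro pos DB)
    qed (rule \<phi>01 \<phi>D \<phi>l \<phi>r lpos rpos; assumption)+
    ultimately show ?thesis unfolding G_def by (simp add: prod.distrib mult_ac)
  qed
  have Gnn: "0 \<le> G x" for x unfolding G_def by (auto intro!: mult_nonneg_nonneg prod_nonneg)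
  have Dm: "(\<lambda>x. D (x i) (x j)) \<in> borel_measurable (lebesgue_Rn n)" if "i \<in> {1..n}" "j \<in> {1..n}" for i j
    unfolding D_def using that coordinate_measurable[of i n] coordinate_measurable[of j n] by measurable
  have qm: "(\<lambda>x. q (x i)) \<in> borel_measurable (lebesgue_Rn n)" if "i \<in> {1..n}" for i
    unfolding q_def using that coordinate_measurable[of i n] by measurable
  have Gm: "G \<in> borel_measurable (lebesgue_Rn n)"
    unfolding G_def
    by (intro borel_measurable_prod borel_measurable_times powr_real_measurable borel_measurable_add
        borel_measurable_diff borel_measurable_uminus coordinate_measurable Dm qm borel_measurable_const) auto
  have Lm: "L \<in> borel_measurable (lebesgue_Rn n)"
    unfolding L_def
    by (intro borel_measurable_sum borel_measurable_times borel_measurable_add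
        borel_measurable_diff borel_measurable_uminus coordinate_measurable Dm qm borel_measurable_const) auto
  \<comment> \<open>Both sides of the change of variables are the total mass of the ensemble.\<close>
  have int1: "(\<integral>\<^sup>+x. ennreal (G x) \<partial>J) = 1"
  proof -
    let ?w = "\<lambda>s. ennreal (1 + c * D s s) * indicator {0..1} s"
    have "(\<integral>\<^sup>+x. ennreal (G x) \<partial>J) = (\<integral>\<^sup>+x. ennreal (f x) * ennreal (G x) \<partial>lebesgue_Rn n)"
      unfolding jacobi_measure_def using Gm by (intro nn_integral_density) auto
    also have "\<dots> = (\<integral>\<^sup>+x. (\<Prod>i\<in>{1..n}. ?w (x i)) * ennreal (f (\<lambda>i\<in>{1..n}. \<phi> (x i))) \<partial>lebesgue_Rn n)"
    proof (intro nn_integral_cong)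
      fix x :: "nat \<Rightarrow> real"
      show "ennreal (f x) * ennreal (G x) = (\<Prod>i\<in>{1..n}. ?w (x i)) * ennreal (f (\<lambda>i\<in>{1..n}. \<phi> (x i)))"
      proof (cases "\<forall>i\<in>{1..n}. 0 \<le> x i \<and> x i \<le> 1")
        case True
        have "(\<Prod>i\<in>{1..n}. ?w (x i)) = (\<Prod>i\<in>{1..n}. ennreal (1 + c * D (x i) (x i)))"
          using True by (intro prod.cong) auto
        also have "\<dots> = ennreal (\<Prod>i\<in>{1..n}. 1 + c * D (x i) (x i))"
          using True by (intro prod_ennreal Dpos) auto
        finally have w: "(\<Prod>i\<in>{1..n}. ?w (x i)) = ennreal (\<Prod>i\<in>{1..n}. 1 + c * D (x i) (x i))" .
        have "0 \<le> (\<Prod>i\<in>{1..n}. 1 + c * D (x i) (x i))"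
          using True by (intro prod_nonneg ballI Dpos) auto
        then show ?thesis unfolding w
          by (simp only: ennreal_mult[symmetric] f_nonneg Gnn fG[OF True])
      next
        case False
        then obtain i where i: "i \<in> {1..n}" "\<not> (0 \<le> x i \<and> x i \<le> 1)" by auto
        then have "(\<Prod>i\<in>{1..n}. ?w (x i)) = 0" by (intro prod_zero) (auto intro!: bexI[of _ i])
        moreover have "f x = 0" by (simp only: jacobi_density_def if_not_P[OF False] if_False)
        ultimately show ?thesis by simp
      qed
    qed
    also have "\<dots> = (\<integral>\<^sup>+x. (\<Prod>i\<in>{1..n}. indicator {0..1} (x i)) * ennreal (f x) \<partial>lebesgue_Rn n)"
      unfolding lebesgue_Rn_def
    proof (rule nn_integral_PiM_substitution)
      show "\<phi> \<in> borel_measurable borel" unfolding \<phi>_def q_def by measurable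
      show "?w \<in> borel_measurable borel" unfolding D_def by measurable
      show "(\<lambda>x. ennreal (f x)) \<in> borel_measurable (Pi\<^sub>M {1..n} (\<lambda>_. lborel))"
        using jacobi_density_measurable[of \<beta> n a1 a2] unfolding lebesgue_Rn_def by measurable
      have "emeasure (density lborel (indicator {0..1::real})) (space (density lborel (indicator {0..1::real}))) \<noteq> \<infinity>"
        by (simp add: emeasure_density)
      then show "sigma_finite_measure (density lborel (indicator {0..1::real}))"
        by (intro finite_measure.axioms finite_measureI)
      fix A :: "real set" assume A: "A \<in> sets borel"
      have 01: "\<phi> 0 = 0" "\<phi> 1 = 1" by (simp_all add: \<phi>_def)
      have "(\<integral>\<^sup>+s. indicator A s * indicator {\<phi> 0..\<phi> 1} s \<partial>lborel)
          = (\<integral>\<^sup>+s. indicator A (\<phi> s) * ennreal (1 + c * D s s) * indicator {0..1} s \<partial>lborel)"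
        using A by (intro nn_integral_substitution_aux deriv Dpos)
          (auto simp: D_def intro!: continuous_intros)
      then show "(\<integral>\<^sup>+s. ?w s * indicator A (\<phi> s) \<partial>lborel) = (\<integral>\<^sup>+s. indicator {0..1} s * indicator A s \<partial>lborel)"
        unfolding 01 by (simp add: mult_ac)
    qed auto
    also have "\<dots> = (\<integral>\<^sup>+x. ennreal (f x) \<partial>lebesgue_Rn n)"
    proof (intro nn_integral_cong)
      fix x :: "nat \<Rightarrow> real"
      show "(\<Prod>i\<in>{1..n}. indicator {0..1} (x i)) * ennreal (f x) = ennreal (f x)"
      proof (cases "\<forall>i\<in>{1..n}. 0 \<le> x i \<and> x i \<le> 1")
        case False
        then have "f x = 0" by (simp only: jacobi_density_def if_not_P[OF False] if_False)
        then show ?thesis by simp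
      qed simp
    qed
    finally show ?thesis by (simp add: nn_integral_f)
  qed
  have Gint: "integrable J G" "expectation G = 1"
    using int1 Gnn measurable_J[OF Gm]
    by (auto simp: integral_eq_nn_integral intro!: integrableI_nonneg)
  have lower: "1 + (c * L x - C * c\<^sup>2) \<le> G x" if x: "\<forall>i\<in>{1..n}. 0 \<le> x i \<and> x i \<le> 1" for x
  proof -
    let ?e = "\<lambda>\<alpha> t. c * (\<alpha> * t) - c\<^sup>2 * (2 * B\<^sup>2 * \<bar>\<alpha>\<bar>)"
    have "c * L x - C * c\<^sup>2 = (\<Sum>i=1..n. \<Sum>j\<in>{i<..n}. ?e \<beta> (D (x i) (x j))) +
       (\<Sum>i=1..n. ?e (a1 - p) ((1 - x i) * q (x i)) + ?e (a2 - p) (- (x i * q (x i))) + ?e 1 (D (x i) (x i)))"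
      unfolding L_def C_def using \<beta>_pos
      by (simp add: sum.distrib sum_subtractf sum_distrib_left algebra_simps)
    then have "exp (c * L x - C * c\<^sup>2) = (\<Prod>i=1..n. \<Prod>j\<in>{i<..n}. exp (?e \<beta> (D (x i) (x j)))) *
       (\<Prod>i=1..n. exp (?e (a1 - p) ((1 - x i) * q (x i))) * exp (?e (a2 - p) (- (x i * q (x i)))) * exp (?e 1 (D (x i) (x i))))"
      by (simp only: exp_add exp_sum finite_atLeastAtMost finite_greaterThanAtMost)
    also have "\<dots> \<le> G x" unfolding G_def
      using x c
      by (intro mult_mono prod_mono conjI one_plus_powr_ge prod_nonneg ballI mult_nonneg_nonneg)
         (auto simp: DB tB qB)
    finally show ?thesis using exp_ge_add_one_self[of "c * L x - C * c\<^sup>2"] by linarith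
  qed
  \<comment> \<open>A crude bound for \<open>L\<close> on the cube, which makes it integrable.\<close>
  define K where "K = \<beta> * (\<Sum>i=1..n. \<Sum>j\<in>{i<..n}. B) + (\<Sum>i=1..n. \<bar>a1 - p\<bar> * B + \<bar>a2 - p\<bar> * B + B)"
  have Lint: "integrable J L"
  proof (rule integrable_bounded_on_cube[OF Lm, of K])
    fix x :: "nat \<Rightarrow> real" assume x: "\<forall>i\<in>{1..n}. 0 \<le> x i \<and> x i \<le> 1"
    have "\<bar>\<Sum>i=1..n. \<Sum>j\<in>{i<..n}. D (x i) (x j)\<bar> \<le> (\<Sum>i=1..n. \<Sum>j\<in>{i<..n}. B)"
      using x by (intro order_trans[OF sum_abs] sum_mono DB) auto
    then have "\<bar>\<beta> * (\<Sum>i=1..n. \<Sum>j\<in>{i<..n}. D (x i) (x j))\<bar> \<le> \<beta> * (\<Sum>i=1..n. \<Sum>j\<in>{i<..n}. B)"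
      using \<beta>_pos by (simp add: abs_mult mult_left_mono)
    moreover have "\<bar>\<Sum>i=1..n. (a1 - p) * ((1 - x i) * q (x i)) + (a2 - p) * (- (x i * q (x i))) + D (x i) (x i)\<bar>
       \<le> (\<Sum>i=1..n. \<bar>a1 - p\<bar> * B + \<bar>a2 - p\<bar> * B + B)"
    proof (intro order_trans[OF sum_abs] sum_mono)
      fix i assume "i \<in> {1..n}"
      with x have xi: "0 \<le> x i" "x i \<le> 1" by auto
      have "\<bar>(a1 - p) * ((1 - x i) * q (x i))\<bar> \<le> \<bar>a1 - p\<bar> * B"
        unfolding abs_mult[of "a1 - p"] using xi by (intro mult_left_mono tB qB) auto
      moreover have "\<bar>(a2 - p) * (- (x i * q (x i)))\<bar> \<le> \<bar>a2 - p\<bar> * B"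
        unfolding abs_mult[of "a2 - p"] abs_minus_cancel using xi by (intro mult_left_mono tB qB) auto
      moreover have "\<bar>D (x i) (x i)\<bar> \<le> B" using xi by (intro DB)
      ultimately show "\<bar>(a1 - p) * ((1 - x i) * q (x i)) + (a2 - p) * (- (x i * q (x i))) + D (x i) (x i)\<bar>
         \<le> \<bar>a1 - p\<bar> * B + \<bar>a2 - p\<bar> * B + B" by linarith
    qed
    ultimately show "\<bar>L x\<bar> \<le> K" unfolding L_def K_def by linarith
  qed
  have "expectation (\<lambda>x. 1 + (c * L x - C * c\<^sup>2)) \<le> expectation G"
    using Lint Gint AE_support lower support_cube
    by (intro integral_mono_AE) (auto elim!: eventually_mono)
  then show "c * expectation L \<le> C * c\<^sup>2"
    using Lint Gint prob_space by simp
qed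

definition s1 :: "(nat \<Rightarrow> real) \<Rightarrow> real" where "s1 x = (\<Sum>i=1..n. x i)"
definition s2 :: "(nat \<Rightarrow> real) \<Rightarrow> real" where "s2 x = (\<Sum>i=1..n. (x i)\<^sup>2)"

lemma integrable_moments: "integrable J s1" "integrable J s2" "integrable J (\<lambda>x. (s1 x)\<^sup>2)"
proof -
  have m: "s1 \<in> borel_measurable (lebesgue_Rn n)" "s2 \<in> borel_measurable (lebesgue_Rn n)"
    unfolding s1_def s2_def
    by (intro borel_measurable_sum borel_measurable_power coordinate_measurable; assumption)+
  have b1: "\<bar>s1 x\<bar> \<le> real n" if "\<forall>i\<in>{1..n}. 0 \<le> x i \<and> x i \<le> 1" for x
    using that sum_bounded_above[of "{1..n}" x 1] unfolding s1_def
    by (subst abs_of_nonneg) (auto intro!: sum_nonneg)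
  have b2: "\<bar>s2 x\<bar> \<le> real n" if "\<forall>i\<in>{1..n}. 0 \<le> x i \<and> x i \<le> 1" for x
    using that sum_bounded_above[of "{1..n}" "\<lambda>i. (x i)\<^sup>2" 1] unfolding s2_def
    by (subst abs_of_nonneg) (auto intro!: sum_nonneg simp: power_le_one)
  show "integrable J s1" "integrable J s2"
    by (rule integrable_bounded_on_cube[OF m(1) b1] integrable_bounded_on_cube[OF m(2) b2]; assumption)+
  show "integrable J (\<lambda>x. (s1 x)\<^sup>2)"
  proof (rule integrable_bounded_on_cube)
    show "(\<lambda>x. (s1 x)\<^sup>2) \<in> borel_measurable (lebesgue_Rn n)" using m by measurable
    show "\<bar>(s1 x)\<^sup>2\<bar> \<le> (real n)\<^sup>2" if "\<forall>i\<in>{1..n}. 0 \<le> x i \<and> x i \<le> 1" for x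
      using b1[OF that] by (simp add: abs_le_square_iff[symmetric])
  qed
qed

text \<open>The first-order coefficient \<open>L\<close> has expectation \<open>0\<close>; for a vector field with the linear factor
  \<open>u + v s\<close> it is a polynomial in the first two power sums.\<close>

lemma loop_equation:
  fixes u v :: real
  shows "expectation (\<lambda>x. u * (real n * a1 - (a1 + a2) * s1 x) +
     v * ((a1 + p) * s1 x - (a1 + a2 + 1 - \<beta> / 2) * s2 x - \<beta> / 2 * (s1 x)\<^sup>2)) = 0"
proof -
  define D where "D = (\<lambda>s t. u * (1 - s - t) + v * (s + t - s\<^sup>2 - s * t - t\<^sup>2))"
  define L where "L = (\<lambda>x. \<beta> * (\<Sum>i=1..n. \<Sum>j\<in>{i<..n}. D (x i) (x j)) +
      (\<Sum>i=1..n. (a1 - p) * ((1 - x i) * (u + v * x i)) + (a2 - p) * (- (x i * (u + v * x i))) + D (x i) (x i)))"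
  define B where "B = \<bar>u\<bar> + 3 * \<bar>v\<bar> + 1"
  have B: "B > 0" by (simp add: B_def add_nonneg_pos)
  note quad = loop_equation_quadratic_error[of _ u v, folded B_def, folded D_def, folded L_def]
  have "expectation L = 0"
  proof (rule eq_zero_of_quadratic_bound)
    show "0 < 1 / (2 * B)" using B by simp
    show "0 \<le> 2 * B\<^sup>2 * (\<beta> * (\<Sum>i=1..n. \<Sum>j\<in>{i<..n}. 1) + real n * (\<bar>a1 - p\<bar> + \<bar>a2 - p\<bar> + 1))"
      using quad(2)[of 0] by simp
    fix c :: real assume "\<bar>c\<bar> \<le> 1 / (2 * B)"
    then have "\<bar>c\<bar> * B \<le> 1 / 2" using B by (simp add: field_simps)
    from quad(1)[OF this]
    show "c * expectation L \<le> 2 * B\<^sup>2 * (\<beta> * (\<Sum>i=1..n. \<Sum>j\<in>{i<..n}. 1) + real n * (\<bar>a1 - p\<bar> + \<bar>a2 - p\<bar> + 1)) * c\<^sup>2"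
      unfolding L_def D_def .
  qed
  moreover have L_eq: "L x = u * (real n * a1 - (a1 + a2) * s1 x) +
     v * ((a1 + p) * s1 x - (a1 + a2 + 1 - \<beta> / 2) * s2 x - \<beta> / 2 * (s1 x)\<^sup>2)" for x
  proof -
    have folds: "sum x {Suc 0..n} = s1 x" "(\<Sum>i=Suc 0..n. (x i)\<^sup>2) = s2 x"
      by (simp_all add: s1_def s2_def)
    \<comment> \<open>With \<open>p = 1 + \<beta> (n - 1) / 2\<close>, the diagonal terms combine with the two-body terms into the coefficients
      \<open>a1\<close>, \<open>a1 + a2\<close> and \<open>a1 + p\<close>.\<close>
    have "2 * (\<Sum>i=1..n. \<Sum>j\<in>{i<..n}. D (x i) (x j)) =
       (\<Sum>i=1..n. \<Sum>j=1..n. D (x i) (x j)) - (\<Sum>i=1..n. D (x i) (x i))"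
      by (rule sum_pairs_symmetric) (simp add: D_def algebra_simps)
    moreover have "(\<Sum>i=1..n. \<Sum>j=1..n. D (x i) (x j)) =
       u * ((real n)\<^sup>2 - 2 * real n * s1 x) + v * (2 * real n * s1 x - 2 * real n * s2 x - (s1 x)\<^sup>2)"
    proof -
      have "(\<Sum>i=1..n. \<Sum>j=1..n. x i * x j) = (s1 x)\<^sup>2"
        by (simp add: s1_def power2_eq_square sum_product)
      then show ?thesis
        unfolding D_def
        by (simp add: sum.distrib sum_subtractf sum_distrib_left[symmetric] folds)
           (simp add: algebra_simps power2_eq_square)
    qed
    moreover have "(\<Sum>i=1..n. D (x i) (x i)) = u * (real n - 2 * s1 x) + v * (2 * s1 x - 3 * s2 x)"
    proof -
      have "D t t = u * (1 - 2 * t) + v * (2 * t - 3 * t\<^sup>2)" for t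
        by (simp add: D_def algebra_simps power2_eq_square)
      then show ?thesis
        by (simp add: sum.distrib sum_subtractf sum_distrib_left[symmetric] folds)
    qed
    moreover have "(\<Sum>i=1..n. (a1 - p) * ((1 - x i) * (u + v * x i)) + (a2 - p) * (- (x i * (u + v * x i))) + D (x i) (x i))
      = (a1 - p) * (u * real n + (v - u) * s1 x - v * s2 x) - (a2 - p) * (u * s1 x + v * s2 x) + (\<Sum>i=1..n. D (x i) (x i))"
    proof -
      have "(\<Sum>i=1..n. (1 - x i) * (u + v * x i)) = u * real n + (v - u) * s1 x - v * s2 x"
      proof -
        have "(1 - t) * (u + v * t) = u + (v - u) * t - v * t\<^sup>2" for t
          by (simp add: algebra_simps power2_eq_square)
        then show ?thesis
          by (simp add: sum.distrib sum_subtractf sum_distrib_left[symmetric] folds)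
      qed
      moreover have "(\<Sum>i=1..n. x i * (u + v * x i)) = u * s1 x + v * s2 x"
      proof -
        have "t * (u + v * t) = u * t + v * t\<^sup>2" for t
          by (simp add: algebra_simps power2_eq_square)
        then show ?thesis
          by (simp add: sum.distrib sum_distrib_left[symmetric] folds)
      qed
      ultimately show ?thesis
        by (simp add: sum.distrib sum_subtractf sum_distrib_left[symmetric])
    qed
    ultimately have "2 * L x = \<beta> * (u * ((real n)\<^sup>2 - 2 * real n * s1 x) + v * (2 * real n * s1 x - 2 * real n * s2 x - (s1 x)\<^sup>2)
        - (u * (real n - 2 * s1 x) + v * (2 * s1 x - 3 * s2 x)))
      + 2 * ((a1 - p) * (u * real n + (v - u) * s1 x - v * s2 x) - (a2 - p) * (u * s1 x + v * s2 x)
        + (u * (real n - 2 * s1 x) + v * (2 * s1 x - 3 * s2 x)))"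
      unfolding L_def by algebra
    then show ?thesis unfolding p_exponent_def by (simp add: field_simps power2_eq_square)
  qed
  ultimately show ?thesis unfolding L_eq[symmetric] by simp
qed

text \<open>The loop equation with \<open>u = 1\<close> and \<open>v = 0\<close>, which closes on the first moment alone.\<close>

lemma expectation_s1: "(a1 + a2) * expectation s1 = real n * a1"
  using loop_equation[of 1 0] integrable_moments prob_space by simp

text \<open>The loop equation with \<open>u = 0\<close> and \<open>v = 1\<close> involves the expectation of \<open>(s1)\<^sup>2\<close>. Estimating it
  by \<open>n s2\<close> avoids a third loop equation and costs only lower order terms, since it changes the
  coefficient \<open>a1 + a2 + 1 - \<beta> / 2\<close> of \<open>s2\<close> into \<open>a1 + a2 + p\<close>.\<close>

lemma expectation_s2:
  "(a1 + p) * expectation s1 \<le> (a1 + a2 + p) * expectation s2"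
proof -
  have "(a1 + p) * expectation s1 = (a1 + a2 + 1 - \<beta> / 2) * expectation s2 + \<beta> / 2 * expectation (\<lambda>x. (s1 x)\<^sup>2)"
    using loop_equation[of 0 1] integrable_moments by simp
  moreover have "expectation (\<lambda>x. (s1 x)\<^sup>2) \<le> expectation (\<lambda>x. real n * s2 x)"
  proof (rule integral_mono)
    show "(s1 x)\<^sup>2 \<le> real n * s2 x" for x
      using Cauchy_Schwarz_ineq_sum[of "\<lambda>_. 1" x "{1..n}"] by (simp add: s1_def s2_def)
  qed (use integrable_moments in auto)
  then have "\<beta> / 2 * expectation (\<lambda>x. (s1 x)\<^sup>2) \<le> \<beta> / 2 * (real n * expectation s2)"
    using \<beta>_pos integrable_moments by (intro mult_left_mono) auto
  moreover have "(a1 + a2 + p) * expectation s2 = (a1 + a2 + 1 - \<beta> / 2) * expectation s2 + \<beta> / 2 * (real n * expectation s2)"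
    by (simp add: p_exponent_def field_simps)
  ultimately show ?thesis by linarith
qed

end

section \<open>The normalising constants\<close>

text \<open>By the mean value theorem and monotonicity of the digamma function, since
  \<open>ln_Gamma (x + 1) - ln_Gamma x = ln x\<close>.\<close>

lemma Digamma_le_ln:
  assumes x: "(0::real) < x"
  shows "Digamma x \<le> ln x"
proof -
  have "\<exists>\<xi>. x < \<xi> \<and> \<xi> < x + 1 \<and> ln_Gamma (x + 1) - ln_Gamma x = (x + 1 - x) * Digamma \<xi>"
    using x by (intro MVT2) (auto intro!: derivative_eq_intros)
  then obtain \<xi> where \<xi>: "x < \<xi>" "ln_Gamma (x + 1) - ln_Gamma x = Digamma \<xi>" by auto
  have "ln_Gamma (x + 1) - ln_Gamma x = ln x"
    using x Gamma_real_pos[OF x] Gamma_plus1[of x]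
    by (simp add: ln_Gamma_real_pos ln_mult nonpos_Ints_def less_imp_neq[symmetric] del: Gamma_real_pos)
  with \<xi> x show ?thesis using Digamma_real_mono[of x \<xi>] by simp
qed

text \<open>The factor \<open>1 / 2\<close> in the quadratic term is essential: with \<open>n\<close> such factors, \<open>y\<close> of order \<open>a2\<close> and \<open>a = a1\<close>,
  this term is of order \<open>n a1\<^sup>2 / a2\<close>, which need not be small and has to cancel to leading order later on.\<close>

lemma ln_Gamma_diff_le:
  assumes y: "(0::real) < y" and a: "0 \<le> a"
  shows "ln_Gamma (y + a) - ln_Gamma y \<le> a * ln y + a\<^sup>2 / (2 * y)"
proof -
  let ?g = "\<lambda>a. a * ln y + a\<^sup>2 / (2 * y) - (ln_Gamma (y + a) - ln_Gamma y)"
  have "?g 0 \<le> ?g a"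
  proof (rule DERIV_nonneg_imp_nondecreasing[OF a], intro exI conjI)
    fix t :: real assume t: "0 \<le> t" "t \<le> a"
    show "(?g has_real_derivative ln y + t / y - Digamma (y + t)) (at t)"
      using y t by (auto intro!: derivative_eq_intros simp: field_simps power2_eq_square)
    have "Digamma (y + t) \<le> ln (y + t)" using y t by (intro Digamma_le_ln) auto
    also have "\<dots> = ln y + ln (1 + t / y)"
    proof -
      have "0 < 1 + t / y" using y t by (intro add_pos_nonneg) auto
      then show ?thesis using y ln_mult[of y "1 + t / y"] by (simp add: distrib_left)
    qed
    also have "ln (1 + t / y) \<le> t / y" using y t by (intro ln_add_one_self_le_self) auto
    finally show "0 \<le> ln y + t / y - Digamma (y + t)" by simp
  qed
  then show ?thesis by simp
qed

lemma sum_descending: "(\<Sum>j=1..n. real n - real j) = real n * (real n - 1) / 2"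
proof -
  have "(\<Sum>j=1..n. real j) = real n * (real n + 1) / 2"
    by (induction n) (auto simp: field_simps)
  then show ?thesis by (simp add: sum_subtractf field_simps)
qed

text \<open>The argument of the logarithm is the ratio of the constants of the Jacobi and Laguerre densities
  after rescaling. All Gamma factors cancel except the quotients
  \<open>Gamma (a1 + a2 - b j) / Gamma (a2 - b j)\<close>.\<close>

lemma ln_const_ratio_le:
  fixes \<beta> a1 a2 :: real and n :: nat
  defines "q \<equiv> \<beta> / 2 * (real n - 1)"
  assumes \<beta>: "\<beta> > 0" and a1: "a1 > q" and a2: "a2 > q" and n: "n \<ge> 1"
  shows "ln (jacobi_const \<beta> n a1 a2 / (laguerre_const \<beta> n a1 * (2 * a2) powr (real n * a1)))
    \<le> real n * (a1\<^sup>2 / (2 * (a2 - q)) - a1 * q / (2 * a2))"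
proof -
  define b where "b = (\<lambda>j. \<beta> / 2 * (real n - real j))"
  have q0: "0 \<le> q" using \<beta> n by (simp add: q_def)
  have bj: "0 \<le> b j" "b j \<le> q" "0 < a2 - b j" "0 < a1 - b j" "0 < a1 + a2 - b j" if "j \<in> {1..n}" for j
  proof -
    show "0 \<le> b j" "b j \<le> q" using that \<beta> by (auto simp: b_def q_def intro!: mult_left_mono)
    then show "0 < a2 - b j" "0 < a1 - b j" "0 < a1 + a2 - b j" using a1 a2 q0 by linarith+
  qed
  have a2p: "0 < a2" using a2 q0 by linarith
  let ?R = "\<lambda>j. Gamma (a1 + a2 - b j) / (Gamma (a2 - b j) * a2 powr a1)"
  have "jacobi_const \<beta> n a1 a2 / (laguerre_const \<beta> n a1 * (2 * a2) powr (real n * a1)) = (\<Prod>j=1..n. ?R j)"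
  proof -
    define A where "A = (\<Prod>j=1..n. Gamma (1 + \<beta> / 2) / (Gamma (1 + \<beta> / 2 * real j) * Gamma (a1 - b j)))"
    have "A > 0" unfolding A_def
    proof (intro prod_pos)
      fix j assume j: "j \<in> {1..n}"
      have "0 \<le> \<beta> / 2 * real j" using \<beta> by simp
      then show "0 < Gamma (1 + \<beta> / 2) / (Gamma (1 + \<beta> / 2 * real j) * Gamma (a1 - b j))"
        using \<beta> bj[OF j] by (intro divide_pos_pos mult_pos_pos Gamma_real_pos) linarith+
    qed
    have "jacobi_const \<beta> n a1 a2 = A * (\<Prod>j=1..n. Gamma (a1 + a2 - b j) / Gamma (a2 - b j))"
      unfolding jacobi_const_def A_def b_def prod.distrib[symmetric] by (simp add: mult_ac)
    also have "(\<Prod>j=1..n. Gamma (a1 + a2 - b j) / Gamma (a2 - b j)) = (\<Prod>j=1..n. ?R j * a2 powr a1)"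
      using a2p by (intro prod.cong refl) simp
    also have "\<dots> = (\<Prod>j=1..n. ?R j) * a2 powr (real n * a1)"
      unfolding prod.distrib using a2p by (simp add: powr_power mult.commute)
    finally have "jacobi_const \<beta> n a1 a2 = A * (\<Prod>j=1..n. ?R j) * a2 powr (real n * a1)" by simp
    moreover have "laguerre_const \<beta> n a1 * (2 * a2) powr (real n * a1) = A * a2 powr (real n * a1)"
      unfolding laguerre_const_def A_def b_def using a2p by (simp add: powr_mult powr_minus field_simps)
    ultimately show ?thesis using \<open>A > 0\<close> a2p by simp
  qed
  also have "ln (\<Prod>j=1..n. ?R j) = (\<Sum>j=1..n. ln (?R j))"
  proof (rule ln_prod)
    fix j assume "j \<in> {1..n}"
    from bj[OF this] a2p have "0 < ?R j"
      by (intro divide_pos_pos mult_pos_pos Gamma_real_pos) auto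
    then show "?R j \<noteq> 0" by (rule less_imp_neq[symmetric])
  qed simp
  also have "\<dots> \<le> (\<Sum>j=1..n. a1\<^sup>2 / (2 * (a2 - q)) - a1 / a2 * b j)"
  proof (rule sum_mono)
    fix j assume j: "j \<in> {1..n}"
    note bj = bj[OF j]
    have "ln (?R j) = ln_Gamma (a2 - b j + a1) - ln_Gamma (a2 - b j) - a1 * ln a2"
      using bj a2p by (simp add: ln_div ln_mult ln_Gamma_real_pos Gamma_real_pos less_imp_neq[symmetric] algebra_simps)
    also have "\<dots> \<le> a1 * ln (a2 - b j) + a1\<^sup>2 / (2 * (a2 - b j)) - a1 * ln a2"
      using ln_Gamma_diff_le[of "a2 - b j" a1] bj a1 q0 by linarith
    also have "a1 * ln (a2 - b j) = a1 * ln a2 + a1 * ln (1 + - (b j / a2))"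
    proof -
      have "0 < 1 - b j / a2" using bj a2p by (simp add: field_simps)
      then have "ln (a2 * (1 - b j / a2)) = ln a2 + ln (1 - b j / a2)" using a2p by (simp only: ln_mult) simp
      then show ?thesis using a2p by (simp add: algebra_simps)
    qed
    also have "a1 * ln (1 + - (b j / a2)) \<le> a1 * - (b j / a2)"
      using bj a2p a1 q0 by (intro mult_left_mono ln_add_one_self_le_self2) (auto simp: field_simps)
    also have "a1\<^sup>2 / (2 * (a2 - b j)) \<le> a1\<^sup>2 / (2 * (a2 - q))"
      using bj a2 by (intro divide_left_mono mult_pos_pos) auto
    finally show "ln (?R j) \<le> a1\<^sup>2 / (2 * (a2 - q)) - a1 / a2 * b j" by simp
  qed
  also have "\<dots> = real n * (a1\<^sup>2 / (2 * (a2 - q))) - a1 / a2 * (\<beta> / 2 * (real n * (real n - 1) / 2))"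
  proof -
    have "(\<Sum>j=1..n. b j) = \<beta> / 2 * (real n * (real n - 1) / 2)"
      unfolding b_def sum_distrib_left[symmetric] sum_descending ..
    moreover have "(\<Sum>j=1..n. a1 / a2 * b j) = a1 / a2 * (\<Sum>j=1..n. b j)"
      by (rule sum_distrib_left[symmetric])
    ultimately show ?thesis unfolding sum_subtractf by (simp only: sum_constant card_atLeastAtMost) simp
  qed
  also have "\<dots> = real n * (a1\<^sup>2 / (2 * (a2 - q)) - a1 * q / (2 * a2))"
  proof -
    have "a1 / a2 * (\<beta> / 2 * (real n * (real n - 1) / 2)) = real n * (a1 * q / (2 * a2))"
      by (simp add: q_def mult_ac)
    then show ?thesis by (simp only: right_diff_distrib)
  qed
  finally show ?thesis .
qed

section \<open>The likelihood ratio\<close>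

text \<open>The homogeneity of the Vandermonde factor: its degree is \<open>\<beta>\<close> times the number of pairs.\<close>

lemma prod_pairs_const_powr:
  fixes t :: real
  assumes "t > 0"
  shows "(\<Prod>i=1..n. \<Prod>j\<in>{i<..n}. t powr \<beta>) = t powr (\<beta> / 2 * (real n - 1) * real n)"
proof -
  have "(\<Prod>i=1..n. \<Prod>j\<in>{i<..n}. t powr \<beta>) = (\<Prod>i=1..n. t powr (\<beta> * (real n - real i)))"
    using assms by (intro prod.cong refl) (simp add: powr_power of_nat_diff mult.commute)
  also have "\<dots> = t powr (\<Sum>i=1..n. \<beta> * (real n - real i))"
    using assms by (simp add: powr_sum)
  also have "(\<Sum>i=1..n. \<beta> * (real n - real i)) = \<beta> / 2 * (real n - 1) * real n"
    unfolding sum_distrib_left[symmetric] sum_descending by simp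
  finally show ?thesis .
qed

text \<open>At \<open>x i = 1\<close> the factor \<open>(1 - x i) powr _\<close> is \<open>0\<close> for every exponent, by the convention
  \<open>0 powr e = 0\<close>.\<close>

lemma jacobi_density_pos_less_one:
  assumes x: "jacobi_density \<beta> n a1 a2 x > 0" and i: "i \<in> {1..n}"
  shows "x i < 1"
proof (rule ccontr)
  assume "\<not> x i < 1"
  moreover have "x i \<le> 1" using x i by (auto simp: jacobi_density_def split: if_splits)
  ultimately have "x i = 1" by simp
  then have "(\<Prod>i=1..n. x i powr (a1 - p_exponent \<beta> n) * (1 - x i) powr (a2 - p_exponent \<beta> n)) = 0"
    using i by (intro prod_zero) (auto intro!: bexI[of _ i])
  then have "jacobi_density \<beta> n a1 a2 x = 0"
    unfolding jacobi_density_def by (simp only: mult_zero_right if_cancel)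
  then show False using x by simp
qed

text \<open>The Laguerre density in the Jacobi coordinates. The powers of \<open>2 * a2\<close> from the Jacobian, the
  Vandermonde factor and the monomials add up to \<open>n a1\<close>; the Vandermonde factors and the powers of the
  \<open>x i\<close> agree, so only the factors \<open>1 - x i\<close> and the exponential survive in the likelihood ratio.\<close>

lemma laguerre_scaled_eq_jacobi:
  assumes \<beta>: "\<beta> > 0" and a1: "a1 > \<beta> / 2 * (real n - 1)" and a2: "a2 > \<beta> / 2 * (real n - 1)"
    and n: "n \<ge> 1" and x: "jacobi_density \<beta> n a1 a2 x > 0"
  defines "K \<equiv> jacobi_const \<beta> n a1 a2 / (laguerre_const \<beta> n a1 * (2 * a2) powr (real n * a1))"
    and "p \<equiv> p_exponent \<beta> n"
  shows "(2 * a2) ^ n * laguerre_density \<beta> n a1 (scale_Rn n (2 * a2) x) =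
    jacobi_density \<beta> n a1 a2 x * exp (- (ln K + (\<Sum>i=1..n. (a2 - p) * ln (1 - x i) + a2 * x i)))"
proof -
  have a2p: "a2 > 0"
  proof -
    have "0 \<le> \<beta> / 2 * (real n - 1)" using \<beta> n by simp
    then show ?thesis using a2 by linarith
  qed
  have cJ: "jacobi_const \<beta> n a1 a2 > 0" and cL: "laguerre_const \<beta> n a1 > 0"
    using jacobi_const_pos laguerre_const_pos \<beta> a1 a2 by auto
  then have K: "K > 0" using a2p by (simp add: K_def)
  have cube: "\<forall>i\<in>{1..n}. 0 \<le> x i \<and> x i \<le> 1"
    using x by (auto simp: jacobi_density_def split: if_splits)
  have lt1: "x i < 1" if i: "i \<in> {1..n}" for i
    using x i by (rule jacobi_density_pos_less_one)
  let ?c = "2 * a2" and ?V = "\<Prod>i=1..n. \<Prod>j\<in>{i<..n}. \<bar>x i - x j\<bar> powr \<beta>"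
    and ?X = "\<Prod>i=1..n. x i powr (a1 - p)" and ?S = "\<Sum>i=1..n. x i"
  have V: "(\<Prod>i=1..n. \<Prod>j\<in>{i<..n}. \<bar>scale_Rn n ?c x i - scale_Rn n ?c x j\<bar> powr \<beta>) = ?c powr ((p - 1) * real n) * ?V"
  proof -
    have "(\<Prod>i=1..n. \<Prod>j\<in>{i<..n}. \<bar>scale_Rn n ?c x i - scale_Rn n ?c x j\<bar> powr \<beta>) =
      (\<Prod>i=1..n. \<Prod>j\<in>{i<..n}. ?c powr \<beta> * \<bar>x i - x j\<bar> powr \<beta>)"
    proof (intro prod.cong refl)
      fix i j assume "i \<in> {1..n}" "j \<in> {i<..n}"
      then have "scale_Rn n ?c x i - scale_Rn n ?c x j = ?c * (x i - x j)"
        by (simp add: scale_Rn_def algebra_simps)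
      then show "\<bar>scale_Rn n ?c x i - scale_Rn n ?c x j\<bar> powr \<beta> = ?c powr \<beta> * \<bar>x i - x j\<bar> powr \<beta>"
        using a2p by (simp add: abs_mult powr_mult)
    qed
    also have "\<dots> = ?c powr ((p - 1) * real n) * ?V"
      unfolding prod.distrib p_def p_exponent_def using prod_pairs_const_powr[of ?c \<beta> n] a2p by simp
    finally show ?thesis .
  qed
  have X: "(\<Prod>i=1..n. scale_Rn n ?c x i powr (a1 - p)) = ?c powr ((a1 - p) * real n) * ?X"
  proof -
    have "(\<Prod>i=1..n. scale_Rn n ?c x i powr (a1 - p)) = (\<Prod>i=1..n. ?c powr (a1 - p) * x i powr (a1 - p))"
      using cube a2p by (intro prod.cong refl) (simp add: scale_Rn_def powr_mult)
    then show ?thesis using a2p by (simp add: prod.distrib powr_power mult.commute)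
  qed
  have S: "(\<Sum>i=1..n. scale_Rn n ?c x i) = ?c * ?S"
    by (simp add: scale_Rn_def sum_distrib_left)
  have pos: "\<forall>i\<in>{1..n}. 0 \<le> scale_Rn n ?c x i" using cube a2p by (simp add: scale_Rn_def)
  have c: "?c ^ n * (?c powr ((p - 1) * real n) * ?c powr ((a1 - p) * real n)) = ?c powr (real n * a1)"
  proof -
    have "t ^ n * (t powr ((p - 1) * real n) * t powr ((a1 - p) * real n)) = t powr (real n * a1)"
      if "t > 0" for t :: real
      using that by (simp add: powr_realpow[symmetric] powr_add[symmetric] algebra_simps)
    from this[of ?c] show ?thesis using a2p by (simp only: mult_pos_pos zero_less_numeral)
  qed
  have "?c ^ n * laguerre_density \<beta> n a1 (scale_Rn n ?c x) =
    laguerre_const \<beta> n a1 * (?c ^ n * (?c powr ((p - 1) * real n) * ?c powr ((a1 - p) * real n))) * ?V * ?X * exp (- a2 * ?S)"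
    unfolding laguerre_density_def if_P[OF pos] V X[unfolded p_def] S p_def by (simp add: mult_ac)
  also have "\<dots> = jacobi_const \<beta> n a1 a2 / K * ?V * ?X * exp (- a2 * ?S)"
    unfolding c K_def using cJ cL a2p by simp
  also have "\<dots> = jacobi_density \<beta> n a1 a2 x * exp (- (ln K + (\<Sum>i=1..n. (a2 - p) * ln (1 - x i) + a2 * x i)))"
  proof -
    have "(\<Prod>i=1..n. x i powr (a1 - p) * (1 - x i) powr (a2 - p)) = ?X * exp (\<Sum>i=1..n. (a2 - p) * ln (1 - x i))"
    proof -
      have "(1 - x i) powr (a2 - p) = exp ((a2 - p) * ln (1 - x i))" if "i \<in> {1..n}" for i
        using lt1[OF that] by (simp add: powr_def)
      then show ?thesis unfolding prod.distrib exp_sum[OF finite_atLeastAtMost]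
        by (intro arg_cong2[where f="(*)"] prod.cong refl)
    qed
    moreover have "exp (- (ln K + (\<Sum>i=1..n. (a2 - p) * ln (1 - x i) + a2 * x i))) =
       exp (- a2 * ?S) / (K * exp (\<Sum>i=1..n. (a2 - p) * ln (1 - x i)))"
    proof -
      have "exp (- (ln K + (T + a2 * S))) = exp (- a2 * S) / (K * exp T)" for T S
        using K by (simp add: exp_diff exp_minus exp_add field_simps)
      then show ?thesis unfolding sum.distrib sum_distrib_left[of a2, symmetric] .
    qed
    ultimately show ?thesis
      unfolding jacobi_density_def if_P[OF cube] p_def[symmetric] by simp
  qed
  finally show ?thesis .
qed

section \<open>Relative entropy\<close>

context jacobi_ensemble begin

text \<open>The logarithm of the likelihood ratio is, up to its constant and after \<open>ln (1 - x) \<le> - x - x\<^sup>2 / 2\<close>,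
  the combination of the first two power sums on the left. Its expectation only needs the exact
  first moment and the lower bound for the second one.\<close>

lemma expected_exponent_le:
  assumes n: "n \<ge> 1" and a2p: "p \<le> a2"
  shows "expectation (\<lambda>x. p * s1 x - (a2 - p) / 2 * s2 x)
    \<le> real n * a1 * (p / (a1 + a2) - (a2 - p) * (a1 + p) / (2 * (a1 + a2) * (a1 + a2 + p)))"
proof -
  have p: "p \<ge> 1" using \<beta>_pos n by (simp add: p_exponent_def)
  have a: "a1 > 0" "a2 > 0"
    using a1 a2 p by (simp_all add: p_exponent_def)
  have e1: "expectation s1 = real n * a1 / (a1 + a2)"
    using expectation_s1 a by (simp add: field_simps)
  have e2: "(a1 + p) / (a1 + a2 + p) * expectation s1 \<le> expectation s2"
    using expectation_s2 a p by (simp add: field_simps)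
  have "expectation (\<lambda>x. p * s1 x - (a2 - p) / 2 * s2 x) = p * expectation s1 - (a2 - p) / 2 * expectation s2"
    using integrable_moments by simp
  also have "\<dots> \<le> p * expectation s1 - (a2 - p) / 2 * ((a1 + p) / (a1 + a2 + p) * expectation s1)"
    using e2 a2p by (intro diff_left_mono mult_left_mono) auto
  also have "\<dots> = real n * a1 * (p / (a1 + a2) - (a2 - p) * (a1 + p) / (2 * (a1 + a2) * (a1 + a2 + p)))"
  proof -
    have "a1 + a2 \<noteq> 0" "a1 + a2 + p \<noteq> 0" using a p by auto
    then show ?thesis unfolding e1 by (simp add: divide_simps) (simp add: algebra_simps)
  qed
  finally show ?thesis .
qed

text \<open>An upper bound for the entropy of the rescaled Jacobi ensemble relative to the Laguerre ensemble:
  the first two terms come from the constants (recall \<open>p - 1 = \<beta> (n - 1) / 2\<close>), the last two from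
  the first and second moments. To leading order in \<open>1 / a2\<close> the bracket is
  \<open>(a1 - (p - 1) + 2 * p - (a1 + p)) / (2 * a2) = 1 / (2 * a2)\<close>.\<close>

definition entropy_bound :: real where
  "entropy_bound = real n * a1 * (a1 / (2 * (a2 - (p - 1))) - (p - 1) / (2 * a2)
     + p / (a1 + a2) - (a2 - p) * (a1 + p) / (2 * (a1 + a2) * (a1 + a2 + p)))"

text \<open>The entropy argument. With \<open>g\<close> the Laguerre density transported to the Jacobi coordinates, the
  inequality \<open>1 - r \<le> \<epsilon> / 2 + (r - 1 - ln r) / \<epsilon>\<close> for \<open>r = g / f\<close> is multiplied by \<open>f\<close> and integrated; the terms
  \<open>g - f\<close> integrate to \<open>0\<close>. Replacing \<open>- ln r\<close> by its polynomial majorant \<open>U\<close> makes every integrand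
  obviously integrable.\<close>

lemma measure_diff_le:
  assumes n: "n \<ge> 1" and a2p: "p \<le> a2" and \<epsilon>: "\<epsilon> > 0"
    and lag: "(\<integral>\<^sup>+x. ennreal (laguerre_density \<beta> n a1 x) \<partial>lebesgue_Rn n) = 1"
    and A: "A \<in> sets (lebesgue_Rn n)"
  defines "P \<equiv> distr J (lebesgue_Rn n) (scale_Rn n (2 * a2))"
    and "Q \<equiv> density (lebesgue_Rn n) (\<lambda>x. ennreal (laguerre_density \<beta> n a1 x))"
  shows "measure P A - measure Q A \<le> \<epsilon> / 2 + entropy_bound / \<epsilon>"
proof -
  let ?R = "lebesgue_Rn n" and ?T = "scale_Rn n (2 * a2)"
  define g where "g x = (2 * a2) ^ n * laguerre_density \<beta> n a1 (?T x)" for x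
  define K where "K = jacobi_const \<beta> n a1 a2 / (laguerre_const \<beta> n a1 * (2 * a2) powr (real n * a1))"
  have p: "p \<ge> 1" using \<beta>_pos n by (simp add: p_exponent_def)
  have a: "a1 > 0" "a2 > 0"
    using a1 a2 p by (simp_all add: p_exponent_def)
  have lnn: "0 \<le> laguerre_density \<beta> n a1 x" for x
    using laguerre_const_pos[OF \<beta>_pos a1]
    by (auto simp: laguerre_density_def intro!: mult_nonneg_nonneg prod_nonneg)
  then have gnn: "0 \<le> g x" for x using a by (simp add: g_def)
  have T[measurable]: "?T \<in> measurable ?R ?R"
    unfolding scale_Rn_def lebesgue_Rn_def by measurable
  have fm[measurable]: "f \<in> borel_measurable ?R" by measurable
  have gm[measurable]: "g \<in> borel_measurable ?R" unfolding g_def by measurable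
  note A[measurable]
  \<comment> \<open>The linear change of variables, once with \<open>F = 1\<close> and once with an indicator function.\<close>
  have scale: "(\<integral>\<^sup>+x. ennreal (g x) * F (?T x) \<partial>?R) = (\<integral>\<^sup>+x. ennreal (laguerre_density \<beta> n a1 x) * F x \<partial>?R)"
    if F: "F \<in> borel_measurable ?R" for F
  proof -
    have "(\<integral>\<^sup>+x. ennreal (g x) * F (?T x) \<partial>?R) =
      (\<integral>\<^sup>+x. (\<Prod>i\<in>{1..n}. ennreal (2 * a2)) * (\<lambda>y. ennreal (laguerre_density \<beta> n a1 y) * F y) (\<lambda>i\<in>{1..n}. 2 * a2 * x i) \<partial>?R)"
      using a lnn by (intro nn_integral_cong)
        (simp add: g_def scale_Rn_def ennreal_mult mult.assoc flip: ennreal_power)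
    also have "\<dots> = (\<integral>\<^sup>+x. (\<Prod>i\<in>{1..n}. 1) * (ennreal (laguerre_density \<beta> n a1 x) * F x) \<partial>?R)"
      unfolding lebesgue_Rn_def
    proof (rule nn_integral_PiM_substitution)
      show "(\<lambda>x. ennreal (laguerre_density \<beta> n a1 x) * F x) \<in> borel_measurable (Pi\<^sub>M {1..n} (\<lambda>_. lborel))"
        using laguerre_density_measurable[of \<beta> n a1] F unfolding lebesgue_Rn_def by measurable
      show "sigma_finite_measure (density lborel (\<lambda>_. 1))"
        by (simp add: density_1 lborel.sigma_finite_measure_axioms)
      fix B :: "real set" assume B: "B \<in> sets borel"
      have "(\<integral>\<^sup>+x. indicator B x \<partial>lborel) = ennreal \<bar>2 * a2\<bar> * (\<integral>\<^sup>+x. indicator B (0 + 2 * a2 * x) \<partial>lborel)"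
        using B a by (intro nn_integral_real_affine) auto
      then show "(\<integral>\<^sup>+x. ennreal (2 * a2) * indicator B (2 * a2 * x) \<partial>lborel) = (\<integral>\<^sup>+x. 1 * indicator B x \<partial>lborel)"
        using B a by (subst nn_integral_cmult) auto
    qed auto
    finally show ?thesis by simp
  qed
  have "(\<integral>\<^sup>+x. ennreal (g x) \<partial>?R) = 1" using scale[of "\<lambda>_. 1"] lag by simp
  then have gi: "integrable ?R g" "(\<integral>x. g x \<partial>?R) = 1"
    using gnn by (auto simp: integral_eq_nn_integral intro!: integrableI_nonneg)
  have fi: "integrable ?R f" "(\<integral>x. f x \<partial>?R) = 1"
    using nn_integral_f f_nonneg by (auto simp: integral_eq_nn_integral intro!: integrableI_nonneg)
  define A' where "A' = ?T -` A \<inter> space ?R"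
  have A'[measurable]: "A' \<in> sets ?R" unfolding A'_def by measurable
  have PA: "measure P A = (\<integral>x. f x * indicator A' x \<partial>?R)"
  proof -
    have "emeasure P A = emeasure J A'"
      unfolding P_def A'_def jacobi_measure_def by (subst emeasure_distr) auto
    also have "\<dots> = (\<integral>\<^sup>+x. ennreal (f x * indicator A' x) \<partial>?R)"
      unfolding jacobi_measure_def by (subst emeasure_density) (auto simp: ennreal_mult f_nonneg ennreal_indicator)
    finally show ?thesis using f_nonneg by (simp add: measure_def integral_eq_nn_integral)
  qed
  have QA: "measure Q A = (\<integral>x. g x * indicator A' x \<partial>?R)"
  proof -
    have "emeasure Q A = (\<integral>\<^sup>+x. ennreal (laguerre_density \<beta> n a1 x) * indicator A x \<partial>?R)"
      unfolding Q_def by (subst emeasure_density) auto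
    also have "\<dots> = (\<integral>\<^sup>+x. ennreal (g x) * indicator A (?T x) \<partial>?R)"
      by (rule scale[symmetric]) auto
    also have "\<dots> = (\<integral>\<^sup>+x. ennreal (g x * indicator A' x) \<partial>?R)"
      by (intro nn_integral_cong) (auto simp: ennreal_mult gnn ennreal_indicator A'_def indicator_def)
    finally show ?thesis using gnn by (simp add: measure_def integral_eq_nn_integral)
  qed
  define U where "U x = ln K + (p * s1 x - (a2 - p) / 2 * s2 x)" for x
  have Uint: "integrable J U" unfolding U_def using integrable_moments by auto
  then have fU: "integrable ?R (\<lambda>x. f x * U x)" and EU: "(\<integral>x. f x * U x \<partial>?R) = expectation U"
  proof -
    have Um: "U \<in> borel_measurable ?R" using borel_measurable_integrable[OF Uint] by (simp add: jacobi_measure_def)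
    show "integrable ?R (\<lambda>x. f x * U x)"
      using Uint Um f_nonneg unfolding jacobi_measure_def by (subst (asm) integrable_density) auto
    show "(\<integral>x. f x * U x \<partial>?R) = expectation U"
      using Um f_nonneg unfolding jacobi_measure_def by (subst integral_density) auto
  qed
  have EU_le: "expectation U \<le> entropy_bound"
  proof -
    have "expectation U = ln K + expectation (\<lambda>x. p * s1 x - (a2 - p) / 2 * s2 x)"
      unfolding U_def using integrable_moments prob_space by simp
    also have "\<dots> \<le> real n * (a1\<^sup>2 / (2 * (a2 - (p - 1))) - a1 * (p - 1) / (2 * a2)) +
      real n * a1 * (p / (a1 + a2) - (a2 - p) * (a1 + p) / (2 * (a1 + a2) * (a1 + a2 + p)))"
      using ln_const_ratio_le[OF \<beta>_pos a1 a2 n] expected_exponent_le[OF n a2p]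
      unfolding K_def by (intro add_mono) (simp_all add: p_exponent_def)
    also have "\<dots> = entropy_bound"
      unfolding entropy_bound_def by (simp add: algebra_simps power2_eq_square)
    finally show ?thesis .
  qed
  \<comment> \<open>Where \<open>f\<close> vanishes, the left-hand side is not positive and the right-hand side is not negative.\<close>
  have pw: "f x * indicator A' x - g x * indicator A' x \<le> \<epsilon> / 2 * f x + (g x - f x + f x * U x) / \<epsilon>" for x
  proof (cases "f x = 0")
    case True
    then show ?thesis using gnn \<epsilon> by (auto simp: indicator_def intro: order_trans[of _ 0])
  next
    case False
    with f_nonneg[of x] have fx: "f x > 0" by simp
    define W where "W = ln K + (\<Sum>i=1..n. (a2 - p) * ln (1 - x i) + a2 * x i)"
    have gx: "g x = f x * exp (- W)"
      unfolding g_def W_def K_def by (rule laguerre_scaled_eq_jacobi[OF \<beta>_pos a1 a2 n fx])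
    have cube: "\<forall>i\<in>{1..n}. 0 \<le> x i \<and> x i \<le> 1" by (rule support_cube[OF fx])
    have "W \<le> U x"
    proof -
      have "(\<Sum>i=1..n. (a2 - p) * ln (1 - x i) + a2 * x i) \<le> (\<Sum>i=1..n. p * x i - (a2 - p) / 2 * (x i)\<^sup>2)"
      proof (rule sum_mono)
        fix i assume i: "i \<in> {1..n}"
        have "x i < 1" using fx i by (rule jacobi_density_pos_less_one)
        with cube i have "(a2 - p) * ln (1 - x i) \<le> (a2 - p) * (- x i - (x i)\<^sup>2 / 2)"
          using a2p by (intro mult_left_mono ln_one_minus_le_quadratic) auto
        then show "(a2 - p) * ln (1 - x i) + a2 * x i \<le> p * x i - (a2 - p) / 2 * (x i)\<^sup>2"
          by (simp add: algebra_simps)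
      qed
      also have "\<dots> = p * s1 x - (a2 - p) / 2 * s2 x"
        by (simp add: s1_def s2_def sum_subtractf sum_distrib_left)
      finally show ?thesis by (simp add: W_def U_def)
    qed
    have "(1 - exp (- W)) * indicator A' x \<le> \<epsilon> / 2 + (exp (- W) - 1 + W) / \<epsilon>"
      using one_minus_le_entropy[of "exp (- W)" \<epsilon>] \<epsilon> by (auto simp: indicator_def)
    also have "\<dots> \<le> \<epsilon> / 2 + (exp (- W) - 1 + U x) / \<epsilon>"
      using \<open>W \<le> U x\<close> \<epsilon> by (intro add_left_mono divide_right_mono) auto
    finally have "f x * ((1 - exp (- W)) * indicator A' x) \<le> f x * (\<epsilon> / 2 + (exp (- W) - 1 + U x) / \<epsilon>)"
      using fx by (intro mult_left_mono) auto
    then show ?thesis unfolding gx using \<epsilon> by (simp add: field_simps)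
  qed
  have "measure P A - measure Q A = (\<integral>x. f x * indicator A' x - g x * indicator A' x \<partial>?R)"
    unfolding PA QA using fi gi
    by (intro Bochner_Integration.integral_diff[symmetric] integrable_real_mult_indicator) auto
  also have "\<dots> \<le> (\<integral>x. \<epsilon> / 2 * f x + (g x - f x + f x * U x) / \<epsilon> \<partial>?R)"
    using fi gi fU pw
    by (intro integral_mono Bochner_Integration.integrable_diff integrable_real_mult_indicator
        Bochner_Integration.integrable_add integrable_divide_zero integrable_mult_right_iff[THEN iffD2]) auto
  also have "\<dots> = \<epsilon> / 2 + expectation U / \<epsilon>"
    using fi gi fU EU by simp
  also have "\<dots> \<le> \<epsilon> / 2 + entropy_bound / \<epsilon>"
    using EU_le \<epsilon> by (intro add_left_mono divide_right_mono) auto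
  finally show ?thesis .
qed

end

section \<open>Convergence in variation distance\<close>

text \<open>The cancellation that the theorem rests on: with \<open>a1\<close>, \<open>p\<close> and \<open>n\<close> of order at most \<open>m\<close>, every single summand
  contributes \<open>m\<^sup>3 / a2\<close> in total, whereas the sum is of order \<open>m\<^sup>2 / a2\<close>.\<close>

lemma entropy_bound_le:
  fixes n a1 a2 p :: real
  assumes n: "0 \<le> n" and a1: "0 < a1" "a1 \<le> a2" and p: "1 \<le> p" "2 * p \<le> a2"
  shows "n * a1 * (a1 / (2 * (a2 - (p - 1))) - (p - 1) / (2 * a2)
     + p / (a1 + a2) - (a2 - p) * (a1 + p) / (2 * (a1 + a2) * (a1 + a2 + p)))
     \<le> n * a1 / a2 * (1 / 2 + a1 * p / a2 + (a1 + p) * (2 * a1 + p) / a2)"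
proof -
  have a2: "a2 > 0" using p by linarith
  \<comment> \<open>Each summand is compared with its value to first order in \<open>1 / a2\<close>.\<close>
  have 1: "a1 / (2 * (a2 - (p - 1))) \<le> a1 / (2 * a2) + a1 * p / (a2 * a2)"
  proof -
    have "a1 / (2 * (a2 - (p - 1))) = a1 / (2 * a2) + a1 * (p - 1) / (2 * a2 * (a2 - (p - 1)))"
    proof -
      have "a2 - (p - 1) \<noteq> 0" using p by linarith
      then show ?thesis using a2 by (simp add: divide_simps) (simp add: algebra_simps)
    qed
    also have "a1 * (p - 1) / (2 * a2 * (a2 - (p - 1))) \<le> a1 * p / (a2 * a2)"
    proof (intro frac_le mult_left_mono mult_nonneg_nonneg)
      have "a2 * a2 \<le> a2 * (2 * (a2 - (p - 1)))" using a2 p by (intro mult_left_mono) auto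
      then show "a2 * a2 \<le> 2 * a2 * (a2 - (p - 1))" by (simp add: mult_ac)
    qed (use a1 a2 p in auto)
    finally show ?thesis by simp
  qed
  have 2: "p / (a1 + a2) \<le> p / a2"
    using a1 a2 p by (intro divide_left_mono mult_pos_pos) auto
  have 3: "(a1 + p) / (2 * a2) - (a1 + p) * (2 * a1 + p) / (a2 * a2)
     \<le> (a2 - p) * (a1 + p) / (2 * (a1 + a2) * (a1 + a2 + p))"
  proof -
    have d: "(a1 + a2) * (a1 + a2 + p) > 0" using a1 a2 p by (intro mult_pos_pos) auto
    have "1 / a2 - (a2 - p) / ((a1 + a2) * (a1 + a2 + p))
        = (a1\<^sup>2 + 2 * a1 * a2 + a1 * p + 2 * a2 * p) / (a2 * ((a1 + a2) * (a1 + a2 + p)))"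
    proof -
      have "a1 + a2 \<noteq> 0" "a1 + a2 + p \<noteq> 0" using a1 a2 p by linarith+
      then show ?thesis using a2 by (simp add: divide_simps) (simp add: algebra_simps power2_eq_square)
    qed
    also have "\<dots> \<le> (2 * a2 * (2 * a1 + p)) / (a2 * (a2 * a2))"
    proof (intro frac_le mult_left_mono mult_mono mult_pos_pos)
      have "a1\<^sup>2 \<le> a1 * a2" "a1 * p \<le> a1 * a2"
        using a1 p by (auto simp: power2_eq_square intro!: mult_left_mono)
      then show "a1\<^sup>2 + 2 * a1 * a2 + a1 * p + 2 * a2 * p \<le> 2 * a2 * (2 * a1 + p)"
        by (simp add: algebra_simps)
    qed (use a1 a2 p in auto)
    also have "\<dots> = 2 * (2 * a1 + p) / (a2 * a2)" using a2 by simp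
    finally have "(a1 + p) / 2 * (1 / a2 - (a2 - p) / ((a1 + a2) * (a1 + a2 + p)))
       \<le> (a1 + p) / 2 * (2 * (2 * a1 + p) / (a2 * a2))"
      using a1 p by (intro mult_left_mono) auto
    moreover have "u / (2 * a2) - u * w / (a2 * a2) \<le> T * u / 2"
      if "u / 2 * (1 / a2 - T) \<le> u / 2 * (2 * w / (a2 * a2))" for u w T :: real
      using that by (simp add: right_diff_distrib mult.commute)
    ultimately have "(a1 + p) / (2 * a2) - (a1 + p) * (2 * a1 + p) / (a2 * a2)
        \<le> (a2 - p) / ((a1 + a2) * (a1 + a2 + p)) * (a1 + p) / 2"
      by blast
    also have "T / (X * Y) * u / 2 = T * u / (2 * X * Y)" for T X Y u :: real
      by simp
    finally show ?thesis .
  qed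
  have "a1 / (2 * (a2 - (p - 1))) - (p - 1) / (2 * a2)
     + p / (a1 + a2) - (a2 - p) * (a1 + p) / (2 * (a1 + a2) * (a1 + a2 + p))
     \<le> (a1 / (2 * a2) + a1 * p / (a2 * a2)) - (p - 1) / (2 * a2) + p / a2
       - ((a1 + p) / (2 * a2) - (a1 + p) * (2 * a1 + p) / (a2 * a2))"
    using 1 2 3 by linarith
  also have "\<dots> = (1 / 2 + a1 * p / a2 + (a1 + p) * (2 * a1 + p) / a2) / a2"
    using a2 by (simp add: field_simps)
  finally have "n * a1 * (a1 / (2 * (a2 - (p - 1))) - (p - 1) / (2 * a2)
     + p / (a1 + a2) - (a2 - p) * (a1 + p) / (2 * (a1 + a2) * (a1 + a2 + p)))
     \<le> n * a1 * ((1 / 2 + a1 * p / a2 + (a1 + p) * (2 * a1 + p) / a2) / a2)"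
    using n a1 by (intro mult_left_mono) auto
  then show ?thesis by simp
qed

text \<open>A one-sided bound on all events is two-sided, by passing to complements.\<close>

lemma variation_distance_bounds:
  assumes P: "prob_space P" and Q: "prob_space Q" and S: "sets P = sets Q"
    and le: "\<And>A. A \<in> sets P \<Longrightarrow> measure P A - measure Q A \<le> b"
  shows "0 \<le> variation_distance P Q" "variation_distance P Q \<le> 2 * b"
proof -
  interpret P: prob_space P by fact
  interpret Q: prob_space Q by fact
  have sp: "space P = space Q" using S by (rule sets_eq_imp_space_eq)
  have abs: "\<bar>measure P A - measure Q A\<bar> \<le> b" if A: "A \<in> sets P" for A
  proof -
    have "measure P (space P - A) - measure Q (space P - A) \<le> b" using A by (intro le) auto
    moreover have "measure P (space P - A) = 1 - measure P A" using A by (rule P.prob_compl)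
    moreover have "measure Q (space P - A) = 1 - measure Q A"
      using A unfolding sp S by (rule Q.prob_compl)
    ultimately show ?thesis using le[OF A] by linarith
  qed
  have "(SUP A\<in>sets P. \<bar>measure P A - measure Q A\<bar>) \<le> b"
    by (intro cSUP_least abs) auto
  then show "variation_distance P Q \<le> 2 * b" by (simp add: variation_distance_def)
  have "\<bar>measure P {} - measure Q {}\<bar> \<le> (SUP A\<in>sets P. \<bar>measure P A - measure Q A\<bar>)"
    using abs by (intro cSUP_upper bdd_aboveI2[of _ _ b]) auto
  then show "0 \<le> variation_distance P Q" by (simp add: variation_distance_def)
qed

theorem theorem6:
  fixes \<beta> \<gamma> :: real
    and a1 a2 :: "nat \<Rightarrow> real"
    and M :: "nat \<Rightarrow> 'a measure" and N :: "nat \<Rightarrow> 'b measure"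
    and \<mu> :: "nat \<Rightarrow> 'a \<Rightarrow> (nat \<Rightarrow> real)"
    and lam :: "nat \<Rightarrow> 'b \<Rightarrow> (nat \<Rightarrow> real)"
  assumes "\<beta> > 0"
    and "0 < \<gamma>" and "\<gamma> \<le> 1"
    and "\<And>n. n \<ge> 2 \<Longrightarrow> a1 n > \<beta> / 2 * (real n - 1)"
    and "\<And>n. n \<ge> 2 \<Longrightarrow> a2 n > \<beta> / 2 * (real n - 1)"
    and "\<And>n. n \<ge> 2 \<Longrightarrow> prob_space (M n)"
    and "\<And>n. n \<ge> 2 \<Longrightarrow>
           distributed (M n) (lebesgue_Rn n) (\<mu> n) (\<lambda>x. ennreal (laguerre_density \<beta> n (a1 n) x))"
    and "\<And>n. n \<ge> 2 \<Longrightarrow> prob_space (N n)"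
    and "\<And>n. n \<ge> 2 \<Longrightarrow>
           distributed (N n) (lebesgue_Rn n) (lam n) (\<lambda>x. ennreal (jacobi_density \<beta> n (a1 n) (a2 n) x))"
    and "filterlim a1 at_top at_top"
    and "filterlim a2 at_top at_top"
    and "a1 \<in> o(\<lambda>n. sqrt (a2 n))"
    and "(\<lambda>n. real n) \<in> o(\<lambda>n. sqrt (a2 n))"
    and "(\<lambda>n. real n * \<beta> / (2 * a1 n)) \<longlonglongrightarrow> \<gamma>"
  shows "(\<lambda>n. variation_distance
            (distr (N n) (lebesgue_Rn n) (\<lambda>\<omega>. scale_Rn n (2 * a2 n) (lam n \<omega>)))
            (distr (M n) (lebesgue_Rn n) (\<mu> n))) \<longlonglongrightarrow> 0"
proof -
  let ?V = "\<lambda>n. variation_distance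
            (distr (N n) (lebesgue_Rn n) (\<lambda>\<omega>. scale_Rn n (2 * a2 n) (lam n \<omega>)))
            (distr (M n) (lebesgue_Rn n) (\<mu> n))"
  define p where "p n = p_exponent \<beta> n" for n
  \<comment> \<open>In terms of these null sequences the entropy bound is at most \<open>B n\<close>.\<close>
  define x where "x n = a1 n / sqrt (a2 n)" for n
  define y where "y n = real n / sqrt (a2 n)" for n
  define z where "z n = p n / sqrt (a2 n)" for n
  define B where "B n = y n * x n * (1 / 2 + x n * z n + (x n + z n) * (2 * x n + z n))" for n
  have x0: "x \<longlonglongrightarrow> 0" unfolding x_def by (rule smalloD_tendsto) fact
  have y0: "y \<longlonglongrightarrow> 0" unfolding y_def by (rule smalloD_tendsto) fact
  have "filterlim (\<lambda>n. sqrt (a2 n)) at_top at_top"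
    by (rule filterlim_compose[OF sqrt_at_top]) fact
  then have r0: "(\<lambda>n. inverse (sqrt (a2 n))) \<longlonglongrightarrow> 0"
    by (rule tendsto_inverse_0_at_top)
  have "(\<lambda>n. (1 - \<beta> / 2) * inverse (sqrt (a2 n)) + \<beta> / 2 * y n) \<longlonglongrightarrow> (1 - \<beta> / 2) * 0 + \<beta> / 2 * 0"
    by (intro tendsto_mult tendsto_add tendsto_const r0 y0)
  moreover have "(1 - \<beta> / 2) * inverse (sqrt (a2 n)) + \<beta> / 2 * y n = z n" for n
  proof -
    have "(1 - \<beta> / 2) * inverse t + \<beta> / 2 * (m / t) = (1 + \<beta> / 2 * (m - 1)) / t" for t m :: real
      by (cases "t = 0") (simp_all add: field_simps)
    then show ?thesis by (simp only: y_def z_def p_def p_exponent_def)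
  qed
  ultimately have z0: "z \<longlonglongrightarrow> 0" by simp
  have "B \<longlonglongrightarrow> 0 * 0 * (1 / 2 + 0 * 0 + (0 + 0) * (2 * 0 + 0))"
    unfolding B_def by (intro tendsto_mult tendsto_add tendsto_const x0 y0 z0)
  then have B0: "B \<longlonglongrightarrow> 0" by simp
  have regime: "\<forall>\<^sub>F n in sequentially. 2 \<le> n \<and> 1 \<le> a2 n \<and> x n < 1 \<and> z n < 1 / 2"
    using eventually_ge_at_top[of "2::nat"] assms(11)[unfolded filterlim_at_top, rule_format, of 1]
      order_tendstoD(2)[OF x0, of 1] order_tendstoD(2)[OF z0, of "1 / 2"]
    by (simp add: eventually_conj_iff)
  \<comment> \<open>The parameter \<open>\<epsilon>\<close> is free; optimising it would give a rate of order \<open>sqrt (B n)\<close>.\<close>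
  have bounds: "\<forall>\<^sub>F n in sequentially. 0 \<le> ?V n \<and> ?V n \<le> 2 * (\<epsilon> / 2 + B n / \<epsilon>)" if \<epsilon>: "\<epsilon> > 0" for \<epsilon> :: real
    using regime
  proof eventually_elim
    case (elim n)
    then have n: "2 \<le> n" "1 \<le> n" and a2: "1 \<le> a2 n" by auto
    let ?R = "lebesgue_Rn n"
    let ?P = "distr (N n) ?R (\<lambda>\<omega>. scale_Rn n (2 * a2 n) (lam n \<omega>))" and ?Q = "distr (M n) ?R (\<mu> n)"
    interpret M: prob_space "M n" using assms(6) n by simp
    interpret N: prob_space "N n" using assms(8) n by simp
    note dM = assms(7)[OF n(1)] and dN = assms(9)[OF n(1)]
    have J: "jacobi_measure \<beta> n (a1 n) (a2 n) = distr (N n) ?R (lam n)"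
      using dN by (simp add: distributed_def jacobi_measure_def)
    have lam: "lam n \<in> measurable (N n) ?R" and mu: "\<mu> n \<in> measurable (M n) ?R"
      using dN dM by (auto simp: distributed_def)
    interpret E: jacobi_ensemble \<beta> n "a1 n" "a2 n"
    proof (rule jacobi_ensemble.intro)
      show "prob_space (jacobi_measure \<beta> n (a1 n) (a2 n))"
        unfolding J by (rule N.prob_space_distr[OF lam])
    qed (rule assms(1) assms(4)[OF n(1)] assms(5)[OF n(1)])+
    have T: "scale_Rn n (2 * a2 n) \<in> measurable ?R ?R"
      unfolding scale_Rn_def lebesgue_Rn_def by measurable
    have P: "?P = distr (jacobi_measure \<beta> n (a1 n) (a2 n)) ?R (scale_Rn n (2 * a2 n))"
      unfolding J using lam T by (subst distr_distr) (auto simp: comp_def)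
    have Q: "?Q = density ?R (\<lambda>x. ennreal (laguerre_density \<beta> n (a1 n) x))"
      using dM by (simp add: distributed_def)
    have pP: "prob_space ?P"
      by (rule N.prob_space_distr) (use measurable_compose[OF lam T] in simp)
    have pQ: "prob_space ?Q" by (rule M.prob_space_distr[OF mu])
    have lag: "(\<integral>\<^sup>+x. ennreal (laguerre_density \<beta> n (a1 n) x) \<partial>?R) = 1"
      using prob_space.emeasure_space_1[OF pQ] unfolding Q
      by (simp add: emeasure_density cong: nn_integral_cong)
    let ?s = "sqrt (a2 n)"
    have s: "1 \<le> ?s" "?s * ?s = a2 n" using a2 by auto
    then have sa: "?s \<le> a2 n" using mult_left_mono[of 1 ?s ?s] by simp
    have a1: "0 < a1 n" 
    proof -
      have "0 \<le> \<beta> / 2 * (real n - 1)" using assms(1) n by (intro mult_nonneg_nonneg) auto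
      then show ?thesis using assms(4)[OF n(1)] by linarith
    qed
    have a12: "a1 n \<le> a2 n" and p2: "2 * p n \<le> a2 n"
      using elim s sa by (auto simp: x_def z_def field_simps)
    have p1: "1 \<le> p n" using assms(1) n by (simp add: p_def p_exponent_def)
    have "E.entropy_bound \<le> real n * a1 n / a2 n * (1 / 2 + a1 n * p n / a2 n + (a1 n + p n) * (2 * a1 n + p n) / a2 n)"
      unfolding E.entropy_bound_def p_def[symmetric] using a1 a12 p1 p2 by (intro entropy_bound_le) auto
    also have "\<dots> = B n"
    proof -
      have "a2 n = ?s * ?s" "?s \<noteq> 0" using s by auto
      have "r * a / (t * t) * (1 / 2 + a * q / (t * t) + (a + q) * (2 * a + q) / (t * t))
        = r / t * (a / t) * (1 / 2 + a / t * (q / t) + (a / t + q / t) * (2 * (a / t) + q / t))"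
        if "t \<noteq> 0" for r a t q :: real
        using that by (simp add: field_simps)
      from this[OF \<open>?s \<noteq> 0\<close>] show ?thesis unfolding B_def x_def y_def z_def s(2) .
    qed
    finally have eB: "E.entropy_bound \<le> B n" .
    have diff: "measure ?P A - measure ?Q A \<le> \<epsilon> / 2 + B n / \<epsilon>" if "A \<in> sets ?P" for A
    proof -
      have "measure ?P A - measure ?Q A \<le> \<epsilon> / 2 + E.entropy_bound / \<epsilon>"
        unfolding P Q using that n p1 p2 lag \<epsilon> by (intro E.measure_diff_le) (auto simp: p_def)
      also have "\<dots> \<le> \<epsilon> / 2 + B n / \<epsilon>" using eB \<epsilon> by (intro add_left_mono divide_right_mono) auto
      finally show ?thesis .
    qed
    show ?case using variation_distance_bounds[OF pP pQ _ diff] by simp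
  qed
  show ?thesis
  proof (rule tendstoI)
    fix e :: real assume e: "e > 0"
    have "\<forall>\<^sub>F n in sequentially. B n < e\<^sup>2 / 8" using e by (intro order_tendstoD(2)[OF B0]) auto
    with bounds[OF half_gt_zero[OF e]] show "\<forall>\<^sub>F n in sequentially. dist (?V n) 0 < e"
    proof eventually_elim
      case (elim n)
      have "2 * (e / 2 / 2 + B n / (e / 2)) < 2 * (e / 2 / 2 + (e\<^sup>2 / 8) / (e / 2))"
        using elim e by (intro mult_strict_left_mono add_strict_left_mono divide_strict_right_mono) auto
      also have "\<dots> = e" using e by (simp add: field_simps power2_eq_square)
      finally show ?case using elim by simp
    qed
  qed
qed

end
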